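(* Let $X$ be a max-linear Bayesian network over a directed acyclic graph $\mathcal{D}=(V,E)$ with fixed coefficient matrix $C$. Then for all pairwise disjoint $I,J,K\subseteq V$: if there is no $*$-connecting path relative to $K$ between a node of $I$ and a node of $J$ in the critical DAG $\mathcal{D}^*_K(C)$, then $X_I$ and $X_J$ are conditionally independent given $X_K$.
   Context: Max-linear Bayesian network: $V=\{1,\dots,d\}$, $\mathcal{D}=(V,E)$ is a directed acyclic graph (DAG), $C=(c_{ij})\in[0,\infty)^{d\times d}$ with $c_{ij}>0$ if and only if $j\to i\in E$. The innovations $Z_1,\dots,Z_d$ are independent with atom-free distributions having support $(0,\infty)$. $X=(X_1,\dots,X_d)$ is defined by $X_i=\max\{Z_i,\max_{j\to i\in E}c_{ij}X_j\}$. For $i\neq j$, $c^*_{ij}$ is the maximum over all directed paths from $j$ to $i$ in $\mathcal{D}$ of the product of the edge weights $c_{vu}$ of the edges $u\to v$ of the path ($0$ if there is no path). A directed path from $j$ to $i$ is critical if its weight equals $c^*_{ij}$. A directed path from $j$ to $i$ factors through $K$ if it contains a node $k\in K$ with $k\ne i,j$. Critical DAG: $\mathcal{D}^*_K(C)$ is the graph on $V$ with an edge $j\to i$ ($i\ne j$) if and only if $c^*_{ij}>0$ and no critical directed path from $j$ to $i$ factors through $K$. $*$-connecting paths: an undirected path between $i$ and $j$ in a DAG on $V$ is $*$-connecting relative to $K$ if, up to exchanging $i$ and $j$, it has one of the following forms, where the nodes are distinct, $k\in K$, and all the other nodes shown are not in $K$: (a) $j\to i$; (b) $j\leftarrow j'\to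 i$; (c) $j\to k\leftarrow i$; (d) $j\leftarrow j'\to k\leftarrow i$; (e) $j\leftarrow j'\to k\leftarrow i'\to i$. *)

theory Defs
  imports "HOL-Probability.Probability"
begin

section \<open>Directed paths and their weights\<close>

text \<open>A directed graph is given by its edge relation: \<open>(j, i) \<in> E\<close> stands for the edge from \<open>j\<close>
  to \<open>i\<close>. Coefficients are indexed as in the recursion, so the edge from \<open>j\<close> to \<open>i\<close> has
  weight \<open>c i j\<close>.\<close>

text \<open>A directed path is the list of its nodes and has at least one edge. The nodes are not required
  to be distinct; in an acyclic graph they always are.\<close>

definition dipath :: "('v \<times> 'v) set \<Rightarrow> 'v \<Rightarrow> 'v list \<Rightarrow> 'v \<Rightarrow> bool" where
  "dipath E j p i \<longleftrightarrow>
     2 \<le> length p \<and> hd p = j \<and> last p = i \<and> successively (\<lambda>u v. (u, v) \<in> E) p"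

definition path_weight :: "('v \<Rightarrow> 'v \<Rightarrow> real) \<Rightarrow> 'v list \<Rightarrow> real" where
  "path_weight c p = (\<Prod>n<length p - 1. c (p ! Suc n) (p ! n))"

text \<open>\<open>Max\<close> is meaningful here because a finite acyclic graph has only finitely many directed
  paths.\<close>

definition c_star :: "('v \<times> 'v) set \<Rightarrow> ('v \<Rightarrow> 'v \<Rightarrow> real) \<Rightarrow> 'v \<Rightarrow> 'v \<Rightarrow> real" where
  "c_star E c i j =
     (if \<exists>p. dipath E j p i then Max {path_weight c p | p. dipath E j p i} else 0)"

definition critical_path ::
    "('v \<times> 'v) set \<Rightarrow> ('v \<Rightarrow> 'v \<Rightarrow> real) \<Rightarrow> 'v \<Rightarrow> 'v list \<Rightarrow> 'v \<Rightarrow> bool" where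
  "critical_path E c j p i \<longleftrightarrow> dipath E j p i \<and> path_weight c p = c_star E c i j"

definition factors_through :: "'v list \<Rightarrow> 'v set \<Rightarrow> bool" where
  "factors_through p K \<longleftrightarrow> (\<exists>k\<in>K. k \<in> set p \<and> k \<noteq> hd p \<and> k \<noteq> last p)"

section \<open>The critical DAG and \<open>*\<close>-connecting paths\<close>

definition critical_dag ::
    "'v set \<Rightarrow> ('v \<times> 'v) set \<Rightarrow> ('v \<Rightarrow> 'v \<Rightarrow> real) \<Rightarrow> 'v set \<Rightarrow> ('v \<times> 'v) set" where
  "critical_dag V E c K =
     {(j, i). j \<in> V \<and> i \<in> V \<and> i \<noteq> j \<and> c_star E c i j > 0 \<and>
        \<not> (\<exists>p. critical_path E c j p i \<and> factors_through p K)}"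

text \<open>Undirected paths are lists of nodes as well; in a DAG the orientation of every traversed edge
  is determined by its endpoints. The five forms are
  \<open>j \<rightarrow> i\<close>, \<open>j \<leftarrow> j' \<rightarrow> i\<close>, \<open>j \<rightarrow> k \<leftarrow> i\<close>, \<open>j \<leftarrow> j' \<rightarrow> k \<leftarrow> i\<close> and \<open>j \<leftarrow> j' \<rightarrow> k \<leftarrow> i' \<rightarrow> i\<close>,
  where \<open>k\<close> is the only node in \<open>K\<close>. The reversal in \<open>star_connecting\<close> accounts for exchanging
  the two end nodes.\<close>

inductive star_form :: "('v \<times> 'v) set \<Rightarrow> 'v set \<Rightarrow> 'v list \<Rightarrow> bool" for G K where
  a: "\<lbrakk>distinct [j, i]; {j, i} \<inter> K = {}; (j, i) \<in> G\<rbrakk>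
      \<Longrightarrow> star_form G K [j, i]"
| b: "\<lbrakk>distinct [j, j', i]; {j, j', i} \<inter> K = {}; (j', j) \<in> G; (j', i) \<in> G\<rbrakk>
      \<Longrightarrow> star_form G K [j, j', i]"
| c: "\<lbrakk>distinct [j, k, i]; k \<in> K; {j, i} \<inter> K = {}; (j, k) \<in> G; (i, k) \<in> G\<rbrakk>
      \<Longrightarrow> star_form G K [j, k, i]"
| d: "\<lbrakk>distinct [j, j', k, i]; k \<in> K; {j, j', i} \<inter> K = {};
       (j', j) \<in> G; (j', k) \<in> G; (i, k) \<in> G\<rbrakk>
      \<Longrightarrow> star_form G K [j, j', k, i]"
| e: "\<lbrakk>distinct [j, j', k, i', i]; k \<in> K; {j, j', i', i} \<inter> K = {};
       (j', j) \<in> G; (j', k) \<in> G; (i', k) \<in> G; (i', i) \<in> G\<rbrakk>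
      \<Longrightarrow> star_form G K [j, j', k, i', i]"

definition star_connecting :: "('v \<times> 'v) set \<Rightarrow> 'v set \<Rightarrow> 'v list \<Rightarrow> bool" where
  "star_connecting G K p \<longleftrightarrow> star_form G K p \<or> star_form G K (rev p)"

section \<open>Conditional independence\<close>

text \<open>Random elements \<open>X\<close> and \<open>Y\<close>, with values in \<open>N1\<close> and \<open>N2\<close>, are conditionally independent
  given \<open>Z\<close>, with values in \<open>N3\<close>, if
  \<open>P(X \<in> A, Y \<in> B | Z) = P(X \<in> A | Z) P(Y \<in> B | Z)\<close> almost surely for all measurable \<open>A\<close> and \<open>B\<close>,
  where conditioning is on the sigma-algebra generated by \<open>Z\<close>.\<close>

definition (in prob_space) cond_indep_var ::
    "'b measure \<Rightarrow> ('a \<Rightarrow> 'b) \<Rightarrow> 'c measure \<Rightarrow> ('a \<Rightarrow> 'c) \<Rightarrow> 'd measure \<Rightarrow> ('a \<Rightarrow> 'd) \<Rightarrow> bool" where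
  "cond_indep_var N1 X N2 Y N3 Z \<longleftrightarrow>
     random_variable N1 X \<and> random_variable N2 Y \<and> random_variable N3 Z \<and>
     (\<forall>A\<in>sets N1. \<forall>B\<in>sets N2. AE \<omega> in M.
        real_cond_exp M (vimage_algebra (space M) Z N3)
          (indicator ((X -` A \<inter> space M) \<inter> (Y -` B \<inter> space M))) \<omega> =
        real_cond_exp M (vimage_algebra (space M) Z N3) (indicator (X -` A \<inter> space M)) \<omega> *
        real_cond_exp M (vimage_algebra (space M) Z N3) (indicator (Y -` B \<inter> space M)) \<omega>)"

section \<open>Max-linear Bayesian networks\<close>

definition measure_support :: "'a::topological_space measure \<Rightarrow> 'a set" where
  "measure_support N = {x. \<forall>U. open U \<longrightarrow> x \<in> U \<longrightarrow> emeasure N U > 0}"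

text \<open>The half-line \<open>(0, \<infinity>)\<close> is not closed in the reals. That an innovation has support
  \<open>(0, \<infinity>)\<close> is therefore expressed relative to the half-line: the innovation is almost surely
  positive, and every positive number lies in the topological support of its distribution.\<close>

locale max_linear_bayesian_network = prob_space M
  for M :: "'a measure" +
  fixes d :: nat
    and E :: "(nat \<times> nat) set"
    and c :: "nat \<Rightarrow> nat \<Rightarrow> real"
    and Z :: "nat \<Rightarrow> 'a \<Rightarrow> real"
    and X :: "nat \<Rightarrow> 'a \<Rightarrow> real"
  assumes edges: "E \<subseteq> {1..d} \<times> {1..d}"
    and acyclic: "acyclic E"
    and coeff_nonneg: "\<And>i j. i \<in> {1..d} \<Longrightarrow> j \<in> {1..d} \<Longrightarrow> 0 \<le> c i j"
    and coeff_pos_iff: "\<And>i j. i \<in> {1..d} \<Longrightarrow> j \<in> {1..d} \<Longrightarrow> 0 < c i j \<longleftrightarrow> (j, i) \<in> E"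
    and indep: "indep_vars (\<lambda>_. borel) Z {1..d}"
    and atom_free: "\<And>i x. i \<in> {1..d} \<Longrightarrow> measure (distr M borel (Z i)) {x} = 0"
    and pos: "\<And>i. i \<in> {1..d} \<Longrightarrow> AE \<omega> in M. 0 < Z i \<omega>"
    and support: "\<And>i. i \<in> {1..d} \<Longrightarrow> {0<..} \<subseteq> measure_support (distr M borel (Z i))"
    and recursion: "\<And>i \<omega>. i \<in> {1..d} \<Longrightarrow> \<omega> \<in> space M \<Longrightarrow>
      X i \<omega> = Max (insert (Z i \<omega>) {c i j * X j \<omega> | j. (j, i) \<in> E})"

end

theory Submission
  imports Defs
begin

text \<open>
  Almost surely all innovations are positive, and then the recursion is solved by
  \<open>X\<^sub>i = max\<^sub>j b\<^sub>i\<^sub>j Z\<^sub>j\<close> with \<open>b\<^sub>i\<^sub>j = c\<^sup>*\<^sub>i\<^sub>j\<close> off the diagonal and \<open>b\<^sub>i\<^sub>i = 1\<close>. An innovation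
  attaining the maximum is a source of \<open>X\<^sub>i\<close>. Two facts about this formula carry the proof.

  \<^item> If a critical path from \<open>j\<close> to \<open>i\<close> factors through \<open>k \<in> K\<close>, then \<open>b\<^sub>i\<^sub>j Z\<^sub>j \<le> b\<^sub>i\<^sub>k X\<^sub>k\<close>. Hence
    \<open>X\<^sub>i\<close> is a function of \<open>X\<^sub>K\<close> and of the innovations of \<open>i\<close> and of its parents outside \<open>K\<close> in the
    critical DAG (\<open>x_local_decomposition\<close>). Let \<open>Q\<close> and \<open>Q'\<close> be the sets of nodes whose innovations
    are needed in this way for \<open>X\<^sub>I\<close> and for \<open>X\<^sub>J\<close>.
  \<^item> Observing \<open>X\<^sub>K\<close> bounds \<open>Z\<^sub>j\<close> by the minimum of \<open>X\<^sub>k / b\<^sub>k\<^sub>j\<close> over \<open>k \<in> K\<close>; the minimisers form a set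
    \<open>A\<^sub>j \<subseteq> K\<close> (\<open>tight\<close>) that depends on \<open>X\<^sub>K\<close> only. Since the innovations are independent and have no
    atoms, no two distinct innovations are related by any of the finitely many ratios of
    coefficients. Therefore almost surely every \<open>X\<^sub>k\<close> has a unique source, all nodes of one \<open>A\<^sub>j\<close> share
    it, and if \<open>s\<close> is the source of some observed node, then \<open>A\<^sub>s\<close> consists exactly of the observed
    nodes with source \<open>s\<close> (\<open>tight_same_source\<close>). So for a given value of \<open>X\<^sub>K\<close> the possible sources of a block of observed
    nodes are the \<open>j\<close> with one and the same maximal \<open>A\<^sub>j\<close>.

  Two nodes outside \<open>K\<close> with the same nonempty \<open>A\<^sub>j\<close> have a common child in the critical DAG,
  namely an element of \<open>A\<^sub>j\<close> with no ancestor in \<open>A\<^sub>j\<close> (\<open>tight_eq_common_child\<close>). So if there is no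
  \<open>*\<close>-connecting path, no block has possible sources both in \<open>Q\<close> and in \<open>Q'\<close>.

  The families \<open>\<tau> = (A\<^sub>j)\<^sub>j\<close> yield a finite partition into events determined by \<open>X\<^sub>K\<close>. On one such event
  let \<open>T\<close> be the union of the blocks with possible sources in \<open>Q\<close>, and let \<open>P\<close> consist of \<open>Q\<close> and of
  the nodes that compete for these blocks, without \<open>Q'\<close>. Then \<open>X\<^sub>k\<close> is generated by \<open>U = Z\<^sub>P\<close> for
  \<open>k \<in> T\<close> and by the complementary innovations \<open>W\<close> for \<open>k \<in> K - T\<close>. Thus \<open>X\<^sub>K\<close> is a pair \<open>(f U, g W)\<close>,
  and the event itself is the conjunction of a condition on \<open>(U, g W)\<close> and one on \<open>(W, f U)\<close>. For
  independent \<open>U\<close> and \<open>W\<close> this product structure gives conditional independence of \<open>U\<close> and \<open>W\<close> given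
  \<open>X\<^sub>K\<close> on the event (\<open>indep_var_local_factorization\<close>). The proof adds up the resulting versions of
  \<open>P(X\<^sub>I \<in> A | X\<^sub>K)\<close> over all \<open>\<tau>\<close>.
\<close>

section \<open>Conditional densities for functions of independent variables\<close>

text \<open>The density of the image under \<open>Q\<close> of the measure with density \<open>u\<close> with respect to the image of the
  one with density \<open>v\<close>. For \<open>v = 1\<close> the function \<open>q\<close> is the conditional expectation of \<open>u\<close> given the
  value of \<open>Q\<close>; a general \<open>v\<close> makes it a conditional expectation under a change of measure.\<close>

lemma Radon_Nikodym_image:
  fixes u v :: "'a \<Rightarrow> ennreal"
  assumes Q[measurable]: "Q \<in> measurable M N"
    and u[measurable]: "u \<in> borel_measurable M" and v[measurable]: "v \<in> borel_measurable M"
    and le: "\<And>x. x \<in> space M \<Longrightarrow> u x \<le> v x"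
    and fin: "(\<integral>\<^sup>+ x. v x \<partial>M) < \<infinity>"
  obtains q :: "'b \<Rightarrow> ennreal" where "q \<in> borel_measurable N"
    and "\<And>h. h \<in> borel_measurable N \<Longrightarrow>
      (\<integral>\<^sup>+ x. h (Q x) * u x \<partial>M) = (\<integral>\<^sup>+ x. h (Q x) * q (Q x) * v x \<partial>M)"
proof -
  let ?\<mu> = "distr (density M v) N Q" and ?\<nu> = "distr (density M u) N Q"
  have em: "emeasure (distr (density M w) N Q) A = (\<integral>\<^sup>+ x. w x * indicator A (Q x) \<partial>M)"
    if [measurable]: "w \<in> borel_measurable M" "A \<in> sets N" for w A
  proof -
    have "emeasure (distr (density M w) N Q) A = (\<integral>\<^sup>+ x. w x * indicator (Q -` A \<inter> space M) x \<partial>M)"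
      by (simp add: emeasure_distr emeasure_density)
    also have "\<dots> = (\<integral>\<^sup>+ x. w x * indicator A (Q x) \<partial>M)"
      by (intro nn_integral_cong) (auto simp: indicator_def)
    finally show ?thesis .
  qed
  have "finite_measure ?\<mu>"
  proof
    have "Q -` space N \<inter> space M = space M"
      using measurable_space[OF Q] by auto
    then have "emeasure ?\<mu> (space ?\<mu>) = (\<integral>\<^sup>+ x. v x * indicator (space M) x \<partial>M)"
      by (simp add: emeasure_distr emeasure_density)
    also have "\<dots> = (\<integral>\<^sup>+ x. v x \<partial>M)"
      by (intro nn_integral_cong) auto
    finally show "emeasure ?\<mu> (space ?\<mu>) \<noteq> \<infinity>"
      using fin by simp
  qed
  then interpret finite_measure ?\<mu> .
  have "absolutely_continuous ?\<mu> ?\<nu>"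
    unfolding absolutely_continuous_def
  proof
    fix A assume "A \<in> null_sets ?\<mu>"
    then have [measurable]: "A \<in> sets N" and 0: "emeasure ?\<mu> A = 0" by (auto simp: null_sets_def)
    have "emeasure ?\<nu> A \<le> emeasure ?\<mu> A"
      by (simp add: em) (intro nn_integral_mono mult_right_mono le, auto)
    with 0 show "A \<in> null_sets ?\<nu>" by (auto simp: null_sets_def)
  qed
  then obtain q where q: "q \<in> borel_measurable ?\<mu>" "density ?\<mu> q = ?\<nu>"
    using Radon_Nikodym[of ?\<nu>] by auto
  show ?thesis
  proof
    show [measurable]: "q \<in> borel_measurable N" using q(1) by simp
    fix h :: "'b \<Rightarrow> ennreal" assume [measurable]: "h \<in> borel_measurable N"
    have "(\<integral>\<^sup>+ x. h (Q x) * u x \<partial>M) = (\<integral>\<^sup>+ y. h y \<partial>?\<nu>)"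
      by (simp add: nn_integral_distr nn_integral_density mult.commute)
    also have "\<dots> = (\<integral>\<^sup>+ y. h y \<partial>density ?\<mu> q)" by (simp add: q(2))
    also have "\<dots> = (\<integral>\<^sup>+ x. h (Q x) * q (Q x) * v x \<partial>M)"
      by (simp add: nn_integral_distr nn_integral_density mult_ac)
    finally show "(\<integral>\<^sup>+ x. h (Q x) * u x \<partial>M) = (\<integral>\<^sup>+ x. h (Q x) * q (Q x) * v x \<partial>M)" .
  qed
qed

context prob_space
begin

lemma indep_var_nn_integral:
  assumes ind: "indep_var N1 U N2 W" and h[measurable]: "h \<in> borel_measurable (N1 \<Otimes>\<^sub>M N2)"
  shows "(\<integral>\<^sup>+ x. h (U x, W x) \<partial>M) = (\<integral>\<^sup>+ x. \<integral>\<^sup>+ y. h (U y, W x) \<partial>M \<partial>M)"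
proof -
  have [measurable]: "random_variable N1 U" "random_variable N2 W"
    using ind by (auto dest: indep_var_rv1 indep_var_rv2)
  interpret U: prob_space "distr M N1 U" by (rule prob_space_distr) simp
  interpret W: prob_space "distr M N2 W" by (rule prob_space_distr) simp
  interpret pair_sigma_finite "distr M N1 U" "distr M N2 W" ..
  have "(\<integral>\<^sup>+ x. h (U x, W x) \<partial>M) = (\<integral>\<^sup>+ z. h z \<partial>distr M (N1 \<Otimes>\<^sub>M N2) (\<lambda>x. (U x, W x)))"
    by (simp add: nn_integral_distr)
  also have "\<dots> = (\<integral>\<^sup>+ z. h z \<partial>(distr M N1 U \<Otimes>\<^sub>M distr M N2 W))"
    using ind by (simp add: indep_var_distribution_eq)
  also have "\<dots> = (\<integral>\<^sup>+ w. \<integral>\<^sup>+ u. h (u, w) \<partial>distr M N1 U \<partial>distr M N2 W)"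
    by (rule nn_integral_snd[symmetric]) simp
  also have "\<dots> = (\<integral>\<^sup>+ x. \<integral>\<^sup>+ u. h (u, W x) \<partial>distr M N1 U \<partial>M)"
    by (subst nn_integral_distr) (auto intro!: borel_measurable_nn_integral)
  also have "\<dots> = (\<integral>\<^sup>+ x. \<integral>\<^sup>+ y. h (U y, W x) \<partial>M \<partial>M)"
  proof (rule nn_integral_cong)
    fix x assume "x \<in> space M"
    then have [measurable]: "W x \<in> space N2"
      using measurable_space[OF \<open>random_variable N2 W\<close>] by simp
    show "(\<integral>\<^sup>+ u. h (u, W x) \<partial>distr M N1 U) = (\<integral>\<^sup>+ y. h (U y, W x) \<partial>M)"
      by (subst nn_integral_distr) auto
  qed
  finally show ?thesis .
qed

text \<open>The value of an independent \<open>W\<close> can be held fixed while the event \<open>U \<in> A\<close> is averaged given \<open>f U\<close>: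
  adding \<open>W\<close> to the conditioning on \<open>f U\<close> does not change the conditional probability of \<open>U \<in> A\<close>.\<close>

lemma indep_var_replace_by_density:
  assumes ind: "indep_var N1 U N2 W"
    and f[measurable]: "f \<in> measurable N1 F1" and A[measurable]: "A \<in> sets N1"
    and \<kappa>[measurable]: "\<kappa> \<in> borel_measurable F1"
    and \<kappa>_eq: "\<And>h. h \<in> borel_measurable F1 \<Longrightarrow>
      (\<integral>\<^sup>+ x. h (f (U x)) * indicator A (U x) \<partial>M) = (\<integral>\<^sup>+ x. h (f (U x)) * \<kappa> (f (U x)) \<partial>M)"
    and h[measurable]: "h \<in> borel_measurable (N2 \<Otimes>\<^sub>M F1)"
  shows "(\<integral>\<^sup>+ x. h (W x, f (U x)) * indicator A (U x) \<partial>M) =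
         (\<integral>\<^sup>+ x. h (W x, f (U x)) * \<kappa> (f (U x)) \<partial>M)"
proof -
  have [measurable]: "random_variable N1 U" "random_variable N2 W"
    using ind by (auto dest: indep_var_rv1 indep_var_rv2)
  have "(\<integral>\<^sup>+ x. h (W x, f (U x)) * indicator A (U x) \<partial>M) =
      (\<integral>\<^sup>+ x. \<integral>\<^sup>+ y. h (W x, f (U y)) * indicator A (U y) \<partial>M \<partial>M)"
    using indep_var_nn_integral[OF ind, of "\<lambda>(u, w). h (w, f u) * indicator A u"] by simp
  also have "\<dots> = (\<integral>\<^sup>+ x. \<integral>\<^sup>+ y. h (W x, f (U y)) * \<kappa> (f (U y)) \<partial>M \<partial>M)"
  proof (rule nn_integral_cong)
    fix x assume "x \<in> space M"
    then have [measurable]: "W x \<in> space N2"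
      using measurable_space[OF \<open>random_variable N2 W\<close>] by simp
    show "(\<integral>\<^sup>+ y. h (W x, f (U y)) * indicator A (U y) \<partial>M) =
        (\<integral>\<^sup>+ y. h (W x, f (U y)) * \<kappa> (f (U y)) \<partial>M)"
      by (rule \<kappa>_eq[of "\<lambda>m. h (W x, m)"]) simp
  qed
  also have "\<dots> = (\<integral>\<^sup>+ x. h (W x, f (U x)) * \<kappa> (f (U x)) \<partial>M)"
    using indep_var_nn_integral[OF ind, of "\<lambda>(u, w). h (w, f u) * \<kappa> (f u)"] by simp
  finally show ?thesis .
qed

text \<open>The pair \<open>(f U, g W)\<close> screens off \<open>W\<close> from \<open>U\<close>: the conditional expectation \<open>\<beta>\<close> of \<open>\<psi>(W, f U)\<close>
  given this pair remains one given \<open>(U, g W)\<close>. Both sides of the claim are measures in \<open>\<phi>\<close>, so it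
  suffices to take a rectangle \<open>U \<in> A\<close>, \<open>g W \<in> D\<close> for \<open>\<phi>\<close>. There \<open>U \<in> A\<close> is replaced by its conditional
  probability \<open>\<kappa>\<close> given \<open>f U\<close>, which turns the integrand into a function of \<open>(f U, g W)\<close> times \<open>\<psi>\<close>;
  the definition of \<open>\<beta>\<close> applies, and the replacement is undone.\<close>

lemma indep_var_cond_density:
  fixes U W :: "'a \<Rightarrow> 'u" and f :: "'u \<Rightarrow> 'm" and g :: "'u \<Rightarrow> 'n" and \<psi> :: "'u \<times> 'm \<Rightarrow> ennreal"
  assumes ind: "indep_var N1 U N2 W"
    and f[measurable]: "f \<in> measurable N1 F1" and g[measurable]: "g \<in> measurable N2 F2"
    and \<psi>[measurable]: "\<psi> \<in> borel_measurable (N2 \<Otimes>\<^sub>M F1)" and \<psi>_le: "\<And>z. \<psi> z \<le> 1"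
  obtains \<beta> :: "'m \<times> 'n \<Rightarrow> ennreal" where "\<beta> \<in> borel_measurable (F1 \<Otimes>\<^sub>M F2)"
    and "\<And>\<phi>. \<phi> \<in> borel_measurable (N1 \<Otimes>\<^sub>M F2) \<Longrightarrow>
      (\<integral>\<^sup>+ x. \<phi> (U x, g (W x)) * \<psi> (W x, f (U x)) \<partial>M) =
      (\<integral>\<^sup>+ x. \<phi> (U x, g (W x)) * \<beta> (f (U x), g (W x)) \<partial>M)"
proof -
  have [measurable]: "random_variable N1 U" "random_variable N2 W"
    using ind by (auto dest: indep_var_rv1 indep_var_rv2)
  have \<psi>_int: "(\<integral>\<^sup>+ x. \<psi> (W x, f (U x)) \<partial>M) \<le> 1"
    using nn_integral_mono[of M "\<lambda>x. \<psi> (W x, f (U x))" "\<lambda>_. 1"] \<psi>_le by (simp add: emeasure_space_1)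
  obtain \<beta> :: "'m \<times> 'n \<Rightarrow> ennreal" where \<beta>[measurable]: "\<beta> \<in> borel_measurable (F1 \<Otimes>\<^sub>M F2)"
    and \<beta>_eq: "\<And>h. h \<in> borel_measurable (F1 \<Otimes>\<^sub>M F2) \<Longrightarrow>
      (\<integral>\<^sup>+ x. h (f (U x), g (W x)) * \<psi> (W x, f (U x)) \<partial>M) =
      (\<integral>\<^sup>+ x. h (f (U x), g (W x)) * \<beta> (f (U x), g (W x)) * 1 \<partial>M)"
    by (rule Radon_Nikodym_image[of "\<lambda>x. (f (U x), g (W x))" M "F1 \<Otimes>\<^sub>M F2"
          "\<lambda>x. \<psi> (W x, f (U x))" "\<lambda>_. 1"]) (auto simp: \<psi>_le emeasure_space_1)
  let ?L = "distr (density M (\<lambda>x. \<psi> (W x, f (U x)))) (N1 \<Otimes>\<^sub>M F2) (\<lambda>x. (U x, g (W x)))"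
  let ?R = "distr (density M (\<lambda>x. \<beta> (f (U x), g (W x)))) (N1 \<Otimes>\<^sub>M F2) (\<lambda>x. (U x, g (W x)))"
  have int: "(\<integral>\<^sup>+ z. \<phi> z \<partial>distr (density M w) (N1 \<Otimes>\<^sub>M F2) (\<lambda>x. (U x, g (W x)))) =
      (\<integral>\<^sup>+ x. \<phi> (U x, g (W x)) * w x \<partial>M)"
    if [measurable]: "\<phi> \<in> borel_measurable (N1 \<Otimes>\<^sub>M F2)" "w \<in> borel_measurable M" for \<phi> w
    by (simp add: nn_integral_distr nn_integral_density mult.commute)
  have em: "emeasure (distr (density M w) (N1 \<Otimes>\<^sub>M F2) (\<lambda>x. (U x, g (W x)))) S =
      (\<integral>\<^sup>+ x. indicator S (U x, g (W x)) * w x \<partial>M)"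
    if [measurable]: "S \<in> sets (N1 \<Otimes>\<^sub>M F2)" "w \<in> borel_measurable M" for S w
    using int[of "indicator S" w] by (subst nn_integral_indicator[symmetric]) simp_all
  have "?L = ?R"
  proof (rule measure_eqI_generator_eq[OF Int_stable_pair_measure_generator[of N1 F2]])
    show "{a \<times> b |a b. a \<in> sets N1 \<and> b \<in> sets F2} \<subseteq> Pow (space N1 \<times> space F2)"
      by (rule pair_measure_closed)
    show "sets ?L = sigma_sets (space N1 \<times> space F2) {a \<times> b |a b. a \<in> sets N1 \<and> b \<in> sets F2}"
      by (simp add: sets_pair_measure)
    show "sets ?R = sigma_sets (space N1 \<times> space F2) {a \<times> b |a b. a \<in> sets N1 \<and> b \<in> sets F2}"
      by (simp add: sets_pair_measure)
    show "range (\<lambda>_. space N1 \<times> space F2) \<subseteq> {a \<times> b |a b. a \<in> sets N1 \<and> b \<in> sets F2}"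
      by auto
    show "(\<Union>i::nat. space N1 \<times> space F2) = space N1 \<times> space F2" by simp
    show "emeasure ?L (space N1 \<times> space F2) \<noteq> \<infinity>" for i :: nat
    proof -
      have "emeasure ?L (space N1 \<times> space F2) \<le> (\<integral>\<^sup>+ x. \<psi> (W x, f (U x)) \<partial>M)"
        by (subst em) (auto intro!: nn_integral_mono simp: indicator_def)
      also have "\<dots> \<le> 1" by (rule \<psi>_int)
      finally show ?thesis by (auto simp: top_unique)
    qed
    fix S assume "S \<in> {a \<times> b |a b. a \<in> sets N1 \<and> b \<in> sets F2}"
    then obtain A D where S: "S = A \<times> D" and [measurable]: "A \<in> sets N1" "D \<in> sets F2" by auto
    obtain \<kappa> :: "'m \<Rightarrow> ennreal" where \<kappa>[measurable]: "\<kappa> \<in> borel_measurable F1"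
      and \<kappa>_eq: "\<And>h. h \<in> borel_measurable F1 \<Longrightarrow>
        (\<integral>\<^sup>+ x. h (f (U x)) * indicator A (U x) \<partial>M) = (\<integral>\<^sup>+ x. h (f (U x)) * \<kappa> (f (U x)) * 1 \<partial>M)"
      by (rule Radon_Nikodym_image[of "\<lambda>x. f (U x)" M F1 "\<lambda>x. indicator A (U x)" "\<lambda>_. 1"])
        (auto simp: emeasure_space_1 indicator_def)
    note repl = indep_var_replace_by_density[OF ind f \<open>A \<in> sets N1\<close> \<kappa> \<kappa>_eq[simplified mult_1_right]]
    have "emeasure ?L S = (\<integral>\<^sup>+ x. (indicator D (g (W x)) * \<psi> (W x, f (U x))) * indicator A (U x) \<partial>M)"
      by (simp add: em S indicator_times mult_ac)
    also have "\<dots> = (\<integral>\<^sup>+ x. (indicator D (g (W x)) * \<psi> (W x, f (U x))) * \<kappa> (f (U x)) \<partial>M)"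
      using repl[of "\<lambda>(w, m). indicator D (g w) * \<psi> (w, m)"] by simp
    also have "\<dots> = (\<integral>\<^sup>+ x. (indicator D (g (W x)) * \<kappa> (f (U x))) * \<beta> (f (U x), g (W x)) \<partial>M)"
      using \<beta>_eq[of "\<lambda>(m, n). indicator D n * \<kappa> m"] by (simp add: mult_ac)
    also have "\<dots> = (\<integral>\<^sup>+ x. (indicator D (g (W x)) * \<beta> (f (U x), g (W x))) * \<kappa> (f (U x)) \<partial>M)"
      by (simp add: mult_ac)
    also have "\<dots> = (\<integral>\<^sup>+ x. (indicator D (g (W x)) * \<beta> (f (U x), g (W x))) * indicator A (U x) \<partial>M)"
      using repl[of "\<lambda>(w, m). indicator D (g w) * \<beta> (m, g w)"] by simp
    also have "\<dots> = emeasure ?R S"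
      by (simp add: em S indicator_times mult_ac)
    finally show "emeasure ?L S = emeasure ?R S" .
  qed
  show ?thesis
  proof (rule that[OF \<beta>])
    fix \<phi> :: "'u \<times> 'n \<Rightarrow> ennreal" assume [measurable]: "\<phi> \<in> borel_measurable (N1 \<Otimes>\<^sub>M F2)"
    have "(\<integral>\<^sup>+ x. \<phi> (U x, g (W x)) * \<psi> (W x, f (U x)) \<partial>M) = (\<integral>\<^sup>+ z. \<phi> z \<partial>?L)"
      by (rule int[symmetric]) auto
    also have "\<dots> = (\<integral>\<^sup>+ x. \<phi> (U x, g (W x)) * \<beta> (f (U x), g (W x)) \<partial>M)"
      unfolding \<open>?L = ?R\<close> by (rule int) auto
    finally show "(\<integral>\<^sup>+ x. \<phi> (U x, g (W x)) * \<psi> (W x, f (U x)) \<partial>M) =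
        (\<integral>\<^sup>+ x. \<phi> (U x, g (W x)) * \<beta> (f (U x), g (W x)) \<partial>M)" .
  qed
qed

text \<open>Conditional independence on an event \<open>Y \<in> D\<close> on which \<open>Y\<close> carries the same information as
  \<open>(f U, g W)\<close> and which splits into the conditions \<open>E1\<close> and \<open>E2\<close>. The witness for \<open>q\<close> is the conditional
  probability of \<open>A\<close> under \<open>E1\<close> alone, given \<open>(f U, g W)\<close>. That the condition \<open>E2\<close> and the event \<open>S\<close>
  can be added on both sides is the screening property: they involve \<open>W\<close> and \<open>f U\<close> only, hence may be
  replaced by a weight \<open>\<beta>(f U, g W)\<close>.\<close>

lemma indep_var_local_factorization:
  fixes U W :: "'a \<Rightarrow> 'u" and f :: "'u \<Rightarrow> 'm" and g :: "'u \<Rightarrow> 'n"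
  assumes ind: "indep_var N1 U N2 W"
    and f[measurable]: "f \<in> measurable N1 F1" and g[measurable]: "g \<in> measurable N2 F2"
    and Y[measurable]: "random_variable N3 Y" and D[measurable]: "D \<in> sets N3"
    and comb[measurable]: "comb \<in> measurable (F1 \<Otimes>\<^sub>M F2) N3"
    and split[measurable]: "split \<in> measurable N3 (F1 \<Otimes>\<^sub>M F2)"
    and E1[measurable]: "E1 \<in> sets (N1 \<Otimes>\<^sub>M F2)" and E2[measurable]: "E2 \<in> sets (N2 \<Otimes>\<^sub>M F1)"
    and event: "AE x in M. Y x \<in> D \<longleftrightarrow> (U x, g (W x)) \<in> E1 \<and> (W x, f (U x)) \<in> E2"
    and on_event: "AE x in M. Y x \<in> D \<longrightarrow>
      Y x = comb (f (U x), g (W x)) \<and> split (Y x) = (f (U x), g (W x))"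
    and A[measurable]: "A \<in> sets (N1 \<Otimes>\<^sub>M N3)"
  obtains q :: "'b \<Rightarrow> ennreal" where "q \<in> borel_measurable N3"
    and "\<And>S. S \<in> sets (N2 \<Otimes>\<^sub>M N3) \<Longrightarrow>
      (\<integral>\<^sup>+ x. indicator A (U x, Y x) * indicator S (W x, Y x) * indicator D (Y x) \<partial>M) =
      (\<integral>\<^sup>+ x. q (Y x) * indicator S (W x, Y x) * indicator D (Y x) \<partial>M)"
proof -
  have [measurable]: "random_variable N1 U" "random_variable N2 W"
    using ind by (auto dest: indep_var_rv1 indep_var_rv2)
  define \<phi> :: "'u \<times> 'n \<Rightarrow> ennreal"
    where "\<phi> = (\<lambda>(u, n). indicator A (u, comb (f u, n)) * indicator E1 (u, n))"
  have [measurable]: "\<phi> \<in> borel_measurable (N1 \<Otimes>\<^sub>M F2)" unfolding \<phi>_def by measurable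
  obtain q0 :: "'m \<times> 'n \<Rightarrow> ennreal" where q0[measurable]: "q0 \<in> borel_measurable (F1 \<Otimes>\<^sub>M F2)"
    and q0_eq: "\<And>h. h \<in> borel_measurable (F1 \<Otimes>\<^sub>M F2) \<Longrightarrow>
      (\<integral>\<^sup>+ x. h (f (U x), g (W x)) * \<phi> (U x, g (W x)) \<partial>M) =
      (\<integral>\<^sup>+ x. h (f (U x), g (W x)) * q0 (f (U x), g (W x)) * indicator E1 (U x, g (W x)) \<partial>M)"
  proof (rule Radon_Nikodym_image[of "\<lambda>x. (f (U x), g (W x))" M "F1 \<Otimes>\<^sub>M F2"
        "\<lambda>x. \<phi> (U x, g (W x))" "\<lambda>x. indicator E1 (U x, g (W x))"])
    show "\<phi> (U x, g (W x)) \<le> indicator E1 (U x, g (W x))" for x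
      by (auto simp: \<phi>_def indicator_def)
    have "(\<integral>\<^sup>+ x. indicator E1 (U x, g (W x)) \<partial>M) \<le> (\<integral>\<^sup>+ x. 1 \<partial>M)"
      by (intro nn_integral_mono) (auto simp: indicator_def)
    then show "(\<integral>\<^sup>+ x. indicator E1 (U x, g (W x)) \<partial>M) < \<infinity>"
      by (auto simp: emeasure_space_1 less_top[symmetric] top_unique)
  qed auto
  show ?thesis
  proof
    show "(\<lambda>y. q0 (split y)) \<in> borel_measurable N3" by measurable
    fix S assume [measurable]: "S \<in> sets (N2 \<Otimes>\<^sub>M N3)"
    define \<psi> :: "'u \<times> 'm \<Rightarrow> ennreal"
      where "\<psi> = (\<lambda>(w, m). indicator S (w, comb (m, g w)) * indicator E2 (w, m))"
    have \<psi>[measurable]: "\<psi> \<in> borel_measurable (N2 \<Otimes>\<^sub>M F1)" unfolding \<psi>_def by measurable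
    have "\<psi> z \<le> 1" for z by (auto simp: \<psi>_def indicator_def split: prod.split)
    from indep_var_cond_density[OF ind f g \<psi> this]
    obtain \<beta> :: "'m \<times> 'n \<Rightarrow> ennreal" where \<beta>[measurable]: "\<beta> \<in> borel_measurable (F1 \<Otimes>\<^sub>M F2)"
      and \<beta>_eq: "\<And>\<phi>. \<phi> \<in> borel_measurable (N1 \<Otimes>\<^sub>M F2) \<Longrightarrow>
        (\<integral>\<^sup>+ x. \<phi> (U x, g (W x)) * \<psi> (W x, f (U x)) \<partial>M) =
        (\<integral>\<^sup>+ x. \<phi> (U x, g (W x)) * \<beta> (f (U x), g (W x)) \<partial>M)" by blast
    have "(\<integral>\<^sup>+ x. indicator A (U x, Y x) * indicator S (W x, Y x) * indicator D (Y x) \<partial>M) =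
        (\<integral>\<^sup>+ x. \<phi> (U x, g (W x)) * \<psi> (W x, f (U x)) \<partial>M)"
      using event on_event
      by (intro nn_integral_cong_AE, elim AE_mp, intro AE_I2) (auto simp: \<phi>_def \<psi>_def indicator_def)
    also have "\<dots> = (\<integral>\<^sup>+ x. \<beta> (f (U x), g (W x)) * \<phi> (U x, g (W x)) \<partial>M)"
      by (simp add: \<beta>_eq mult.commute)
    also have "\<dots> = (\<integral>\<^sup>+ x. \<beta> (f (U x), g (W x)) * q0 (f (U x), g (W x)) *
        indicator E1 (U x, g (W x)) \<partial>M)"
      by (rule q0_eq) simp
    also have "\<dots> = (\<integral>\<^sup>+ x. (q0 (f (U x), g (W x)) * indicator E1 (U x, g (W x))) *
        \<psi> (W x, f (U x)) \<partial>M)"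
      using \<beta>_eq[of "\<lambda>(u, n). q0 (f u, n) * indicator E1 (u, n)"] by (simp add: mult_ac)
    also have "\<dots> =
        (\<integral>\<^sup>+ x. q0 (split (Y x)) * indicator S (W x, Y x) * indicator D (Y x) \<partial>M)"
      using event on_event
      by (intro nn_integral_cong_AE, elim AE_mp, intro AE_I2) (auto simp: \<psi>_def indicator_def)
    finally show "(\<integral>\<^sup>+ x. indicator A (U x, Y x) * indicator S (W x, Y x) * indicator D (Y x) \<partial>M) =
      (\<integral>\<^sup>+ x. q0 (split (Y x)) * indicator S (W x, Y x) * indicator D (Y x) \<partial>M)" .
  qed
qed

text \<open>A one-sided criterion: some function \<open>q\<close> of \<open>Y\<close> is a version of the probability of \<open>X1 \<in> A\<close>
  given \<open>X2\<close> and \<open>Y\<close> together.\<close>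

lemma cond_indep_varI:
  assumes X1[measurable]: "random_variable N1 X1" and X2[measurable]: "random_variable N2 X2"
    and Y[measurable]: "random_variable N3 Y"
    and ex: "\<And>A. A \<in> sets N1 \<Longrightarrow> \<exists>q\<in>borel_measurable N3. \<forall>B\<in>sets N2. \<forall>C\<in>sets N3.
      (\<integral>\<^sup>+ x. indicator A (X1 x) * (indicator B (X2 x) * indicator C (Y x)) \<partial>M) =
      (\<integral>\<^sup>+ x. q (Y x) * (indicator B (X2 x) * indicator C (Y x)) \<partial>M)"
  shows "cond_indep_var N1 X1 N2 X2 N3 Y"
  unfolding cond_indep_var_def
proof (intro conjI ballI)
  fix A B assume A[measurable]: "A \<in> sets N1" and B[measurable]: "B \<in> sets N2"
  let ?F = "vimage_algebra (space M) Y N3"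
  have Y_F[measurable]: "Y \<in> measurable ?F N3"
    using measurable_space[OF Y] by (intro measurable_vimage_algebra1) auto
  have "sets ?F \<subseteq> sets M"
    using Y measurable_space[OF Y] by (subst sets_vimage_algebra2) (auto intro: measurable_sets)
  then have "subalgebra M ?F" by (simp add: subalgebra_def)
  then interpret finite_measure_subalgebra M ?F by unfold_locales
  from ex[OF A] obtain q where q[measurable]: "q \<in> borel_measurable N3"
    and q_eq: "\<And>B C. B \<in> sets N2 \<Longrightarrow> C \<in> sets N3 \<Longrightarrow>
      (\<integral>\<^sup>+ x. indicator A (X1 x) * (indicator B (X2 x) * indicator C (Y x)) \<partial>M) =
      (\<integral>\<^sup>+ x. q (Y x) * (indicator B (X2 x) * indicator C (Y x)) \<partial>M)" by blast
  define p where "p x = enn2real (q (Y x))" for x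
  have p_F[measurable]: "p \<in> borel_measurable ?F" unfolding p_def by measurable
  have p_M[measurable]: "p \<in> borel_measurable M" unfolding p_def by measurable
  have "(\<integral>\<^sup>+ x. q (Y x) \<partial>M) =
      (\<integral>\<^sup>+ x. q (Y x) * (indicator (space N2) (X2 x) * indicator (space N3) (Y x)) \<partial>M)"
    using measurable_space[OF X2] measurable_space[OF Y] by (intro nn_integral_cong) simp
  also have "\<dots> = (\<integral>\<^sup>+ x. indicator A (X1 x) *
      (indicator (space N2) (X2 x) * indicator (space N3) (Y x)) \<partial>M)"
    by (rule q_eq[symmetric]) auto
  also have "\<dots> \<le> (\<integral>\<^sup>+ x. 1 \<partial>M)" by (intro nn_integral_mono) (auto simp: indicator_def)
  finally have q_int: "(\<integral>\<^sup>+ x. q (Y x) \<partial>M) < \<infinity>"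
    by (auto simp: emeasure_space_1 less_top[symmetric] top_unique)
  then have "AE x in M. q (Y x) \<noteq> \<infinity>"
    by (intro nn_integral_noteq_infinite) auto
  then have p_q: "AE x in M. ennreal (p x) = q (Y x)"
    by eventually_elim (simp add: p_def less_top)
  have p_nonneg: "0 \<le> p x" for x by (simp add: p_def)
  have p_int: "integrable M p"
  proof (rule integrableI_nonneg)
    show "(\<integral>\<^sup>+ x. ennreal (p x) \<partial>M) < \<infinity>"
      using q_int nn_integral_cong_AE[OF p_q] by simp
  qed (auto simp: p_nonneg)
  have p_eq: "(\<integral>x. indicator A (X1 x) * (indicator B' (X2 x) * indicator C (Y x)) \<partial>M) =
      (\<integral>x. p x * (indicator B' (X2 x) * indicator C (Y x)) \<partial>M)"
    if [measurable]: "B' \<in> sets N2" "C \<in> sets N3" for B' C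
  proof -
    have "(\<integral>\<^sup>+ x. ennreal (p x * (indicator B' (X2 x) * indicator C (Y x))) \<partial>M) =
        (\<integral>\<^sup>+ x. q (Y x) * (indicator B' (X2 x) * indicator C (Y x)) \<partial>M)"
      using p_q by (intro nn_integral_cong_AE, elim AE_mp, intro AE_I2) (auto simp: indicator_def)
    also have "\<dots> = (\<integral>\<^sup>+ x. indicator A (X1 x) * (indicator B' (X2 x) * indicator C (Y x)) \<partial>M)"
      by (rule q_eq[symmetric]) auto
    also have "\<dots> = (\<integral>\<^sup>+ x. ennreal (indicator A (X1 x) * (indicator B' (X2 x) * indicator C (Y x))) \<partial>M)"
      by (intro nn_integral_cong) (auto simp: indicator_def)
    finally show ?thesis
      by (subst (1 2) integral_eq_nn_integral) (auto simp: p_nonneg)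
  qed
  let ?a = "indicator (X1 -` A \<inter> space M) :: 'a \<Rightarrow> real"
  let ?b = "indicator (X2 -` B \<inter> space M) :: 'a \<Rightarrow> real"
  have [measurable]: "X1 -` A \<inter> space M \<in> sets M" "X2 -` B \<inter> space M \<in> sets M"
    by (auto intro: measurable_sets)
  have a_int: "integrable M ?a" and ab_int:
    "integrable M (indicator ((X1 -` A \<inter> space M) \<inter> (X2 -` B \<inter> space M)) :: 'a \<Rightarrow> real)"
    by (rule integrable_const_bound[of _ 1]; simp)+
  have F_sets: "\<exists>C'\<in>sets N3. C = Y -` C' \<inter> space M" if "C \<in> sets ?F" for C
    using that measurable_space[OF Y] by (subst (asm) sets_vimage_algebra2) auto
  have "AE x in M. real_cond_exp M ?F ?a x = p x"
  proof (rule real_cond_exp_charact)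
    fix C assume "C \<in> sets ?F"
    then obtain C' where C': "C' \<in> sets N3" "C = Y -` C' \<inter> space M" using F_sets by blast
    have "(\<integral>x\<in>C. ?a x \<partial>M) =
        (\<integral>x. indicator A (X1 x) * (indicator (space N2) (X2 x) * indicator C' (Y x)) \<partial>M)"
      using measurable_space[OF X2] unfolding set_lebesgue_integral_def C'(2)
      by (intro Bochner_Integration.integral_cong) (auto simp: indicator_def)
    also have "\<dots> = (\<integral>x. p x * (indicator (space N2) (X2 x) * indicator C' (Y x)) \<partial>M)"
      by (rule p_eq) (auto simp: C')
    also have "\<dots> = (\<integral>x\<in>C. p x \<partial>M)"
      using measurable_space[OF X2] unfolding set_lebesgue_integral_def C'(2)
      by (intro Bochner_Integration.integral_cong) (auto simp: indicator_def)
    finally show "(\<integral>x\<in>C. ?a x \<partial>M) = (\<integral>x\<in>C. p x \<partial>M)" .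
  qed (simp_all add: p_int a_int)
  moreover
  have p2_int: "integrable M (\<lambda>x. p x * ?b x)"
    using integrable_mult_indicator[OF _ p_int, of "X2 -` B \<inter> space M"] by (simp add: mult.commute)
  have "AE x in M. real_cond_exp M ?F (\<lambda>x. p x * ?b x) x = p x * real_cond_exp M ?F ?b x"
    by (rule real_cond_exp_mult) (auto intro: p2_int)
  moreover
  have "AE x in M. real_cond_exp M ?F (indicator ((X1 -` A \<inter> space M) \<inter> (X2 -` B \<inter> space M))) x =
      real_cond_exp M ?F (\<lambda>x. p x * ?b x) x"
  proof (rule real_cond_exp_charact)
    fix C assume C: "C \<in> sets ?F"
    then obtain C' where C': "C' \<in> sets N3" "C = Y -` C' \<inter> space M" using F_sets by blast
    have "(\<integral>x\<in>C. (indicator ((X1 -` A \<inter> space M) \<inter> (X2 -` B \<inter> space M)) x :: real) \<partial>M) =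
        (\<integral>x. indicator A (X1 x) * (indicator B (X2 x) * indicator C' (Y x)) \<partial>M)"
      unfolding set_lebesgue_integral_def C'(2)
      by (intro Bochner_Integration.integral_cong) (auto simp: indicator_def)
    also have "\<dots> = (\<integral>x. p x * (indicator B (X2 x) * indicator C' (Y x)) \<partial>M)"
      by (rule p_eq) (auto simp: C')
    also have "\<dots> = (\<integral>x\<in>C. p x * ?b x \<partial>M)"
      unfolding set_lebesgue_integral_def C'(2)
      by (intro Bochner_Integration.integral_cong) (auto simp: indicator_def)
    also have "\<dots> = (\<integral>x\<in>C. real_cond_exp M ?F (\<lambda>x. p x * ?b x) x \<partial>M)"
      by (rule real_cond_exp_intA[OF p2_int C])
    finally show "(\<integral>x\<in>C. indicator ((X1 -` A \<inter> space M) \<inter> (X2 -` B \<inter> space M)) x \<partial>M) =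
        (\<integral>x\<in>C. real_cond_exp M ?F (\<lambda>x. p x * ?b x) x \<partial>M)" .
  qed (simp_all add: real_cond_exp_int[OF p2_int] ab_int)
  ultimately show "AE x in M.
      real_cond_exp M ?F (indicator ((X1 -` A \<inter> space M) \<inter> (X2 -` B \<inter> space M))) x =
      real_cond_exp M ?F ?a x * real_cond_exp M ?F ?b x"
    by eventually_elim simp
qed (fact X1 X2 Y)+

end

text \<open>Given the value of \<open>T\<close>, a coincidence forces \<open>S\<close> into a single point, a null set for \<open>S\<close>.\<close>

lemma (in prob_space) AE_indep_no_coincidence:
  fixes S T :: "'a \<Rightarrow> real"
  assumes ind: "indep_var borel S borel T"
    and atom_free: "\<And>x. measure (distr M borel S) {x} = 0" and a: "a \<noteq> 0"
  shows "AE \<omega> in M. a * S \<omega> \<noteq> b * T \<omega>"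
proof -
  have [measurable]: "random_variable borel S" "random_variable borel T"
    using ind by (auto dest: indep_var_rv1 indep_var_rv2)
  interpret S: prob_space "distr M borel S" by (rule prob_space_distr) simp
  let ?h = "\<lambda>(s, t). indicator {0} (a * s - b * t) :: ennreal"
  have "(\<integral>\<^sup>+ x. ?h (S x, T x) \<partial>M) = (\<integral>\<^sup>+ x. \<integral>\<^sup>+ y. ?h (S y, T x) \<partial>M \<partial>M)"
    by (rule indep_var_nn_integral[OF ind]) measurable
  also have "\<dots> = (\<integral>\<^sup>+ x. 0 \<partial>M)"
  proof (rule nn_integral_cong)
    fix x
    have "(\<integral>\<^sup>+ y. ?h (S y, T x) \<partial>M) = (\<integral>\<^sup>+ y. indicator {b * T x / a} (S y) \<partial>M)"
      using a by (intro nn_integral_cong) (auto simp: indicator_def field_simps)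
    also have "\<dots> = (\<integral>\<^sup>+ s. indicator {b * T x / a} s \<partial>distr M borel S)"
      by (subst nn_integral_distr) auto
    also have "\<dots> = 0" using atom_free by (simp add: S.emeasure_eq_measure)
    finally show "(\<integral>\<^sup>+ y. ?h (S y, T x) \<partial>M) = 0" .
  qed
  finally have "(\<integral>\<^sup>+ x. ?h (S x, T x) \<partial>M) = 0" by simp
  moreover have "(\<lambda>x. ?h (S x, T x)) \<in> borel_measurable M" by measurable
  ultimately have "AE x in M. ?h (S x, T x) = 0" by (simp only: nn_integral_0_iff_AE)
  then show ?thesis by eventually_elim (auto simp: indicator_def split: if_splits)
qed

lemma (in prob_space) indep_vars_indep_var:
  assumes ind: "indep_vars (\<lambda>_. N) Z A" and "s \<in> A" "t \<in> A" "s \<noteq> t"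
  shows "indep_var N (Z s) N (Z t)"
proof -
  have "indep_var (PiM {s} (\<lambda>_. N)) (\<lambda>\<omega>. \<lambda>i\<in>{s}. Z i \<omega>) (PiM {t} (\<lambda>_. N)) (\<lambda>\<omega>. \<lambda>i\<in>{t}. Z i \<omega>)"
    using assms by (intro indep_var_restrict[OF ind]) auto
  from indep_var_compose[OF this, of "\<lambda>f. f s" N "\<lambda>f. f t" N]
  show ?thesis by (simp add: comp_def)
qed

section \<open>Weights of directed paths\<close>

lemma path_weight_Cons_Cons:
  "path_weight c (u # v # p) = c v u * path_weight c (v # p)"
  by (simp add: path_weight_def prod.lessThan_Suc_shift del: prod.lessThan_Suc)

lemma path_weight_append:
  "path_weight c (p @ k # q) = path_weight c (p @ [k]) * path_weight c (k # q)"
proof (induction p)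
  case Nil
  show ?case by (simp add: path_weight_def)
next
  case (Cons u p)
  then show ?case by (cases p) (simp_all add: path_weight_Cons_Cons, simp add: path_weight_def)
qed

locale weighted_dag =
  fixes V :: "'v set" and E :: "('v \<times> 'v) set" and c :: "'v \<Rightarrow> 'v \<Rightarrow> real"
  assumes finite_V: "finite V" and edges_in_V: "E \<subseteq> V \<times> V" and acyclic_E: "acyclic E"
    and edge_pos: "(j, i) \<in> E \<Longrightarrow> 0 < c i j"
begin

text \<open>The Kleene star of the coefficient matrix in the max-times semiring: the empty path contributes the
  ones on the diagonal.\<close>

definition kleene :: "'v \<Rightarrow> 'v \<Rightarrow> real" where
  "kleene i j = (if i = j then 1 else c_star E c i j)"

lemma walk_sorted: "successively (\<lambda>u v. (u, v) \<in> E) p \<Longrightarrow> sorted_wrt (\<lambda>u v. (u, v) \<in> E\<^sup>+) p"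
  by (subst successively_conv_sorted_wrt[symmetric])
    (auto simp: transp_def intro: successively_mono)

lemma walk_distinct:
  assumes "successively (\<lambda>u v. (u, v) \<in> E) p" shows "distinct p"
proof -
  have "p ! m \<noteq> p ! n" if "m < n" "n < length p" for m n
    using sorted_wrt_nth_less[OF walk_sorted[OF assms] that] acyclic_E by (auto simp: acyclic_def)
  then show ?thesis unfolding distinct_conv_nth by (metis nat_neq_iff)
qed

lemma dipath_trancl:
  assumes "dipath E j p i" shows "(j, i) \<in> E\<^sup>+"
proof -
  have p: "0 < length p - 1" "length p - 1 < length p"
    using assms by (auto simp: dipath_def)
  have "p \<noteq> []" "hd p = j" "last p = i" using assms by (auto simp: dipath_def)
  then have ends: "p ! 0 = j" "p ! (length p - 1) = i" by (auto simp: hd_conv_nth last_conv_nth)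
  have "sorted_wrt (\<lambda>u v. (u, v) \<in> E\<^sup>+) p"
    using assms by (intro walk_sorted) (simp add: dipath_def)
  from sorted_wrt_nth_less[OF this p] show ?thesis by (simp only: ends)
qed

lemma dipath_in_V:
  assumes "dipath E j p i" shows "set p \<subseteq> V"
proof
  fix v assume "v \<in> set p"
  then obtain n where n: "n < length p" "v = p ! n" by (auto simp: in_set_conv_nth)
  have step: "(p ! m, p ! Suc m) \<in> E" if "Suc m < length p" for m
    using assms that by (auto simp: dipath_def successively_conv_nth)
  show "v \<in> V"
  proof (cases "Suc n < length p")
    case True
    then show ?thesis using step[of n] edges_in_V n by auto
  next
    case False
    then have "Suc (n - 1) = n" using assms n by (auto simp: dipath_def)
    then show ?thesis using step[of "n - 1"] edges_in_V n by auto
  qed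
qed

lemma finite_dipaths: "finite {p. dipath E j p i}"
proof (rule finite_subset)
  show "{p. dipath E j p i} \<subseteq> {p. set p \<subseteq> V \<and> distinct p}"
  proof safe
    fix p v assume p: "dipath E j p i"
    show "distinct p" using p by (intro walk_distinct) (simp add: dipath_def)
    show "v \<in> V" if "v \<in> set p" using dipath_in_V[OF p] that by blast
  qed
  show "finite {p. set p \<subseteq> V \<and> distinct p}" by (rule finite_subset_distinct[OF finite_V])
qed

lemma path_weight_pos: "successively (\<lambda>u v. (u, v) \<in> E) p \<Longrightarrow> 0 < path_weight c p"
  by (auto simp: path_weight_def successively_conv_nth intro!: prod_pos edge_pos)

lemma path_weight_le_c_star:
  assumes "dipath E j p i" shows "path_weight c p \<le> c_star E c i j"
proof -
  have "finite {path_weight c p | p. dipath E j p i}"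
    using finite_dipaths[of j i] by simp
  then have "path_weight c p \<le> Max {path_weight c p | p. dipath E j p i}"
    by (rule Max_ge) (use assms in blast)
  moreover have "\<exists>p. dipath E j p i" using assms by blast
  ultimately show ?thesis by (simp add: c_star_def)
qed

lemma critical_path_exists:
  assumes "dipath E j p i" obtains q where "critical_path E c j q i"
proof -
  have "finite {path_weight c p | p. dipath E j p i}"
    using finite_dipaths[of j i] by simp
  then have "Max {path_weight c p | p. dipath E j p i} \<in> {path_weight c p | p. dipath E j p i}"
    using assms by (intro Max_in) auto
  then obtain q where "dipath E j q i" "path_weight c q = Max {path_weight c p | p. dipath E j p i}"
    by fastforce
  moreover have "\<exists>p. dipath E j p i" using assms by blast
  ultimately have "critical_path E c j q i" by (simp add: critical_path_def c_star_def)
  then show ?thesis by (rule that)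
qed

lemma c_star_pos: "dipath E j p i \<Longrightarrow> 0 < c_star E c i j"
  using path_weight_le_c_star[of j p i] path_weight_pos[of p] by (auto simp: dipath_def)

lemma kleene_refl [simp]: "kleene i i = 1"
  by (simp add: kleene_def)

lemma kleene_nonneg [simp]: "0 \<le> kleene i j"
proof (cases "\<exists>p. dipath E j p i")
  case True
  then show ?thesis using c_star_pos by (auto simp: kleene_def less_imp_le)
next
  case False
  then show ?thesis by (simp add: kleene_def c_star_def)
qed

lemma kleene_pos_dipath:
  assumes "0 < kleene i j" "i \<noteq> j" obtains p where "dipath E j p i" "path_weight c p = kleene i j"
proof -
  have "\<exists>p. dipath E j p i" using assms by (auto simp: kleene_def c_star_def split: if_splits)
  then obtain q where "critical_path E c j q i" using critical_path_exists by blast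
  then show ?thesis
    using that[of q] assms by (simp add: critical_path_def kleene_def)
qed

lemma kleene_pos_trancl: "0 < kleene i j \<Longrightarrow> i \<noteq> j \<Longrightarrow> (j, i) \<in> E\<^sup>+"
  by (metis kleene_pos_dipath dipath_trancl)

lemma dipath_le_kleene:
  assumes "dipath E j p i" shows "path_weight c p \<le> kleene i j"
  using path_weight_le_c_star[OF assms] dipath_trancl[OF assms] acyclic_E
  by (auto simp: kleene_def acyclic_def)

lemma dipath_append:
  assumes "dipath E j p k" "dipath E k q i"
  shows "dipath E j (butlast p @ q) i" "path_weight c (butlast p @ q) = path_weight c p * path_weight c q"
proof -
  have p: "p = butlast p @ [k]" using assms(1) by (auto simp: dipath_def) (metis append_butlast_last_id list.size(3) not_numeral_le_zero)
  obtain q' where q: "q = k # q'" using assms(2) by (cases q) (auto simp: dipath_def)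
  have q': "q' \<noteq> []" using assms(2) q by (auto simp: dipath_def)
  show "path_weight c (butlast p @ q) = path_weight c p * path_weight c q"
    using path_weight_append[of c "butlast p" k q'] p q by simp
  have ne: "butlast p \<noteq> []" using assms(1) by (cases p) (auto simp: dipath_def)
  then have "hd (butlast p) = hd p" by (metis p hd_append2)
  moreover have "successively (\<lambda>u v. (u, v) \<in> E) (butlast p @ [k])"
    using assms(1) p by (simp add: dipath_def)
  ultimately show "dipath E j (butlast p @ q) i"
    using assms ne q q' by (auto simp: dipath_def successively_append_iff)
qed

lemma kleene_mult: "kleene i k * kleene k j \<le> kleene i j"
proof (cases "i = k \<or> k = j \<or> kleene i k = 0 \<or> kleene k j = 0")
  case False
  then have "0 < kleene i k" "0 < kleene k j" by (simp_all add: order_less_le)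
  then obtain p q where p: "dipath E j p k" "path_weight c p = kleene k j"
    and q: "dipath E k q i" "path_weight c q = kleene i k"
    using False kleene_pos_dipath by metis
  from dipath_append[OF p(1) q(1)] dipath_le_kleene[of j "butlast p @ q" i]
  show ?thesis by (simp add: p q mult.commute)
qed auto

lemma edge_le_kleene:
  assumes "(j, i) \<in> E" shows "c i j \<le> kleene i j"
proof -
  have "dipath E j [j, i] i" using assms by (simp add: dipath_def)
  then show ?thesis using dipath_le_kleene by (fastforce simp: path_weight_def)
qed

text \<open>Both parts of a critical path are critical themselves, since otherwise replacing one of them would give
  a heavier path.\<close>

lemma kleene_split_critical:
  assumes "critical_path E c j p i" "k \<in> set p" "k \<noteq> j" "k \<noteq> i"
  shows "kleene i j = kleene i k * kleene k j"
proof (rule antisym)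
  have dp: "dipath E j p i" using assms by (simp add: critical_path_def)
  obtain p1 p2 where p: "p = p1 @ k # p2" using split_list[OF assms(2)] by blast
  have ne: "p1 \<noteq> []" "p2 \<noteq> []" using dp assms p by (auto simp: dipath_def)
  have 1: "dipath E j (p1 @ [k]) k" "dipath E k (k # p2) i"
    using dp p ne by (auto simp: dipath_def successively_append_iff neq_Nil_conv)
  have "i \<noteq> j" using dipath_trancl[OF dp] acyclic_E by (auto simp: acyclic_def)
  then have "kleene i j = path_weight c p" using assms by (simp add: critical_path_def kleene_def)
  also have "\<dots> = path_weight c (p1 @ [k]) * path_weight c (k # p2)"
    unfolding p by (rule path_weight_append)
  also have "\<dots> \<le> kleene k j * kleene i k"
    using 1 by (intro mult_mono dipath_le_kleene less_imp_le[OF path_weight_pos] kleene_nonneg)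
      (auto simp: dipath_def)
  finally show "kleene i j \<le> kleene i k * kleene k j" by (simp add: mult.commute)
qed (rule kleene_mult)

section \<open>Max-linear equations and their sources\<close>

text \<open>The nodes whose innovations, besides the observed values on \<open>K\<close>, determine the value at \<open>i\<close>.\<close>

definition local_sources :: "'v set \<Rightarrow> 'v \<Rightarrow> 'v set" where
  "local_sources K i = insert i {j. (j, i) \<in> critical_dag V E c K} - K"

text \<open>The nodes \<open>k\<close> minimising \<open>y k / kleene k j\<close>, that is, those giving the sharpest upper bound on the
  innovation at \<open>j\<close>. The inequality is multiplied out, so that nodes \<open>l\<close> that \<open>j\<close> does not reach impose
  no restriction if \<open>y\<close> is nonnegative.\<close>

definition tight :: "'v set \<Rightarrow> ('v \<Rightarrow> real) \<Rightarrow> 'v \<Rightarrow> 'v set" where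
  "tight K y j = {k \<in> K. 0 < kleene k j \<and> (\<forall>l\<in>K. kleene l j * y k \<le> kleene k j * y l)}"

text \<open>Here \<open>\<tau>\<close> stands for the family of sets \<open>tight K y j\<close>. A set that is properly contained in another one
  cannot belong to the source of its elements, because the source of a node accounts for all nodes that
  share it. So only maximal sets count: \<open>obs_part\<close> collects the observed nodes whose source may lie in
  \<open>Q\<close>, and \<open>src_part\<close> adds to \<open>Q\<close> the competitors for these nodes. A node of \<open>Q'\<close> may meet \<open>obs_part\<close>
  through a set that is not maximal, and is then excluded explicitly.\<close>

definition obs_part :: "('v \<Rightarrow> 'v set) \<Rightarrow> 'v set \<Rightarrow> 'v set" where
  "obs_part \<tau> Q = {k. \<exists>u\<in>Q. k \<in> \<tau> u \<and> (\<forall>j\<in>V. \<tau> u \<subseteq> \<tau> j \<longrightarrow> \<tau> j \<subseteq> \<tau> u)}"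

definition src_part :: "('v \<Rightarrow> 'v set) \<Rightarrow> 'v set \<Rightarrow> 'v set \<Rightarrow> 'v set" where
  "src_part \<tau> Q Q' = (Q \<union> {j \<in> V. \<tau> j \<inter> obs_part \<tau> Q \<noteq> {}}) - Q'"

text \<open>Including \<open>0\<close> gives a value for empty \<open>P\<close>; for nonempty \<open>P\<close> and nonnegative \<open>y\<close> it changes nothing.\<close>

definition wmax :: "'v set \<Rightarrow> 'v \<Rightarrow> ('v \<Rightarrow> real) \<Rightarrow> real" where
  "wmax P i y = Max (insert 0 ((\<lambda>j. kleene i j * y j) ` P))"

lemma wmax_le_iff: "finite P \<Longrightarrow> wmax P i y \<le> b \<longleftrightarrow> 0 \<le> b \<and> (\<forall>j\<in>P. kleene i j * y j \<le> b)"
  by (auto simp: wmax_def)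

lemma wmax_ge: "finite P \<Longrightarrow> j \<in> P \<Longrightarrow> kleene i j * y j \<le> wmax P i y"
  using wmax_le_iff[of P i y "wmax P i y"] by auto

lemma wmax_cong: "(\<And>j. j \<in> P \<Longrightarrow> y j = y' j) \<Longrightarrow> wmax P i y = wmax P i y'"
  by (auto simp: wmax_def cong: image_cong)

lemma tight_cong: "(\<And>k. k \<in> K \<Longrightarrow> y k = y' k) \<Longrightarrow> tight K y j = tight K y' j"
  by (auto simp: tight_def)

lemma obs_part_cong:
  assumes "\<And>j. j \<in> V \<Longrightarrow> \<tau> j = \<tau>' j" "Q \<subseteq> V" shows "obs_part \<tau> Q = obs_part \<tau>' Q"
proof -
  have "\<tau> u = \<tau>' u" if "u \<in> Q" for u using assms that by auto
  then show ?thesis using assms(1) by (simp add: obs_part_def cong: bex_cong ball_cong)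
qed

lemma src_part_cong:
  assumes "\<And>j. j \<in> V \<Longrightarrow> \<tau> j = \<tau>' j" "Q \<subseteq> V" shows "src_part \<tau> Q Q' = src_part \<tau>' Q Q'"
  using obs_part_cong[OF assms] assms(1) by (auto simp: src_part_def)

lemma local_sources_subset: "i \<in> V \<Longrightarrow> local_sources K i \<subseteq> V - K"
  by (auto simp: local_sources_def critical_dag_def)

text \<open>The value at an unobserved node \<open>i\<close> as a function of the innovations \<open>z\<close> and of the values \<open>y\<close> on \<open>K\<close>.\<close>

definition hidden_value :: "'v set \<Rightarrow> 'v \<Rightarrow> ('v \<Rightarrow> real) \<Rightarrow> ('v \<Rightarrow> real) \<Rightarrow> real" where
  "hidden_value K i z y = max (wmax K i y) (wmax (local_sources K i) i z)"

lemma hidden_value_cong: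
  assumes "\<And>k. k \<in> K \<Longrightarrow> y k = y' k" "\<And>j. j \<in> local_sources K i \<Longrightarrow> z j = z' j"
  shows "hidden_value K i z y = hidden_value K i z' y'"
  using wmax_cong[of K y y'] wmax_cong[of "local_sources K i" z z'] assms by (simp add: hidden_value_def)

text \<open>Excludes that two nodes \<open>k\<close> and \<open>l\<close> with different sources \<open>s\<close> and \<open>t\<close> give the same bound on the
  innovation at \<open>u\<close>. The case \<open>k = l = u\<close> says that the source of a node is unique.\<close>

definition generic :: "('v \<Rightarrow> real) \<Rightarrow> bool" where
  "generic z \<longleftrightarrow> (\<forall>s\<in>V. \<forall>t\<in>V. \<forall>u\<in>V. \<forall>k\<in>V. \<forall>l\<in>V. s \<noteq> t \<longrightarrow> 0 < kleene k s \<longrightarrow> 0 < kleene l u \<longrightarrow>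
     kleene l u * kleene k s * z s \<noteq> kleene k u * kleene l t * z t)"

end

locale max_linear_solution = weighted_dag V E c
  for V :: "'v set" and E :: "('v \<times> 'v) set" and c :: "'v \<Rightarrow> 'v \<Rightarrow> real" +
  fixes z x :: "'v \<Rightarrow> real"
  assumes z_pos: "i \<in> V \<Longrightarrow> 0 < z i"
    and recursion: "i \<in> V \<Longrightarrow> x i = Max (insert (z i) {c i j * x j | j. (j, i) \<in> E})"
begin

lemma finite_terms: "finite {c i j * x j | j. (j, i) \<in> E}"
proof -
  have "{c i j * x j | j. (j, i) \<in> E} \<subseteq> (\<lambda>j. c i j * x j) ` V" using edges_in_V by auto
  then show ?thesis using finite_V finite_subset by blast
qed

lemma x_ge_z: "i \<in> V \<Longrightarrow> z i \<le> x i"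
  using finite_terms[of i] by (subst recursion) (auto intro: Max_ge)

lemma x_pos: "i \<in> V \<Longrightarrow> 0 < x i"
  using x_ge_z z_pos by force

lemma x_ge_edge: "(j, i) \<in> E \<Longrightarrow> c i j * x j \<le> x i"
  using finite_terms[of i] edges_in_V by (subst (2) recursion) (auto intro: Max_ge)

lemma x_ge_walk:
  "successively (\<lambda>u v. (u, v) \<in> E) p \<Longrightarrow> p \<noteq> [] \<Longrightarrow> path_weight c p * x (hd p) \<le> x (last p)"
proof (induction p rule: induct_list012)
  case (3 u v p)
  have "path_weight c (u # v # p) * x u = path_weight c (v # p) * (c v u * x u)"
    by (simp add: path_weight_Cons_Cons)
  also have "\<dots> \<le> path_weight c (v # p) * x v"
    using 3 path_weight_pos[of "v # p"] by (intro mult_left_mono x_ge_edge) auto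
  also have "\<dots> \<le> x (last (v # p))" using 3 by simp
  finally show ?case by simp
qed (simp_all add: path_weight_def)

lemma x_ge_kleene:
  assumes "i \<in> V" shows "kleene i j * x j \<le> x i"
proof (cases "i = j \<or> kleene i j = 0")
  case True
  then show ?thesis using x_pos[OF assms] by auto
next
  case False
  then have "0 < kleene i j" "i \<noteq> j" by (simp_all add: order_less_le)
  then obtain p where p: "dipath E j p i" "path_weight c p = kleene i j" by (rule kleene_pos_dipath)
  then have "p \<noteq> []" by (auto simp: dipath_def)
  then show ?thesis using x_ge_walk[of p] p by (simp add: dipath_def)
qed

lemma x_ge_kleene_z: "i \<in> V \<Longrightarrow> j \<in> V \<Longrightarrow> kleene i j * z j \<le> x i"
  using x_ge_kleene[of i j] x_ge_z[of j] mult_left_mono[of "z j" "x j" "kleene i j"] by simp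

text \<open>Follow an edge that attains the maximum backwards, which ends in an innovation since \<open>E\<close> is
  well-founded. The path found in this way may be lighter than the best one, but the value at \<open>i\<close> is an
  upper bound for the contribution of the best one.\<close>

lemma x_source:
  assumes "i \<in> V" obtains j where "j \<in> V" "x i = kleene i j * z j"
proof -
  have "wf E"
    using finite_V edges_in_V acyclic_E by (auto intro: finite_acyclic_wf finite_subset)
  then have "i \<in> V \<longrightarrow> (\<exists>j\<in>V. x i = kleene i j * z j)"
  proof (induction i rule: wf_induct_rule)
    case (less i)
    show ?case
    proof
      assume i: "i \<in> V"
      have "x i \<in> insert (z i) {c i j * x j | j. (j, i) \<in> E}"
        using finite_terms[of i] by (subst recursion[OF i]) (intro Max_in, auto)
      then consider "x i = z i" | l where "(l, i) \<in> E" "x i = c i l * x l" by auto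
      then show "\<exists>j\<in>V. x i = kleene i j * z j"
      proof cases
        case 1
        then show ?thesis using i by (intro bexI[of _ i]) auto
      next
        case 2
        then obtain j where j: "j \<in> V" "x l = kleene l j * z j" using less edges_in_V by auto
        have "x i = c i l * kleene l j * z j" using 2 j by simp
        also have "\<dots> \<le> kleene i l * kleene l j * z j"
          using edge_le_kleene[OF 2(1)] z_pos[OF j(1)] by (intro mult_right_mono) auto
        also have "\<dots> \<le> kleene i j * z j"
          using kleene_mult[of i l j] z_pos[OF j(1)] by (intro mult_right_mono) auto
        finally show ?thesis using x_ge_kleene_z[OF i j(1)] j(1) by (intro bexI[of _ j]) auto
      qed
    qed
  qed
  then show ?thesis using assms that by blast
qed

lemma source_kleene_pos:
  assumes "i \<in> V" "j \<in> V" "x i = kleene i j * z j" shows "0 < kleene i j"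
  using x_pos[OF assms(1)] z_pos[OF assms(2)] assms(3) by (simp add: zero_less_mult_iff)

lemma wmax_le_x: "P \<subseteq> V \<Longrightarrow> i \<in> V \<Longrightarrow> wmax P i z \<le> x i"
  using x_ge_kleene_z x_pos[of i] finite_subset[OF _ finite_V, of P]
  by (subst wmax_le_iff) (auto intro: less_imp_le)

lemma x_eq_max_wmax:
  assumes "P \<subseteq> V" "i \<in> V" shows "x i = max (wmax P i z) (wmax (V - P) i z)"
proof (rule antisym)
  have fin: "finite P" "finite (V - P)" using assms finite_V finite_subset by auto
  obtain s where s: "s \<in> V" "x i = kleene i s * z s" using x_source[OF assms(2)] .
  then show "x i \<le> max (wmax P i z) (wmax (V - P) i z)"
    using wmax_ge[OF fin(1), of s i z] wmax_ge[OF fin(2), of s i z] by (cases "s \<in> P") auto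
qed (use assms wmax_le_x in auto)

text \<open>Let \<open>j\<close> be a source of \<open>i\<close>. If \<open>j\<close> is in \<open>K\<close> or some critical path from \<open>j\<close> to \<open>i\<close> factors through \<open>K\<close>,
  then the contribution of \<open>j\<close> arrives via an observed node and is bounded by that node's value.\<close>

lemma x_local_decomposition:
  assumes i: "i \<in> V - K" and K: "K \<subseteq> V"
  shows "x i = hidden_value K i z x"
  unfolding hidden_value_def
proof (rule antisym)
  have fin: "finite K" "finite (local_sources K i)" and ls: "local_sources K i \<subseteq> V"
    using finite_V K i by (auto simp: local_sources_def critical_dag_def intro: finite_subset)
  show "max (wmax K i x) (wmax (local_sources K i) i z) \<le> x i"
    using x_pos[of i] i ls x_ge_kleene x_ge_kleene_z
    by (auto simp: wmax_le_iff fin intro: less_imp_le)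
  obtain j where j: "j \<in> V" "x i = kleene i j * z j" using x_source i by blast
  have pos: "0 < kleene i j" using source_kleene_pos i j by blast
  show "x i \<le> max (wmax K i x) (wmax (local_sources K i) i z)"
  proof (cases "j \<in> local_sources K i")
    case True
    then show ?thesis using wmax_ge[OF fin(2) True, of i z] j by simp
  next
    case False
    have "\<exists>k\<in>K. kleene i j = kleene i k * kleene k j"
    proof (cases "j \<in> K")
      case True
      then show ?thesis by (intro bexI[of _ j]) auto
    next
      case nK: False
      then have ij: "i \<noteq> j" and "(j, i) \<notin> critical_dag V E c K"
        using False by (auto simp: local_sources_def)
      then obtain p where p: "critical_path E c j p i" "factors_through p K"
        using pos i j ij by (auto simp: critical_dag_def kleene_def)
      then obtain k where "k \<in> K" "k \<in> set p" "k \<noteq> j" "k \<noteq> i"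
        by (auto simp: factors_through_def critical_path_def dipath_def)
      then show ?thesis using kleene_split_critical[OF p(1)] by blast
    qed
    then obtain k where k: "k \<in> K" "kleene i j = kleene i k * kleene k j" by blast
    have "x i = kleene i k * (kleene k j * z j)" using j k by simp
    also have "\<dots> \<le> kleene i k * x k"
      using x_ge_kleene_z k K j by (intro mult_left_mono) auto
    also have "\<dots> \<le> wmax K i x" by (rule wmax_ge[OF fin(1) k(1)])
    finally show ?thesis by simp
  qed
qed

text \<open>If a critical path from \<open>u\<close> to \<open>k\<close> passed through another observed node \<open>l\<close>, the value at \<open>l\<close> would bound
  the innovation at \<open>u\<close> at least as sharply as the value at \<open>k\<close>, because \<open>kleene k l * x l \<le> x k\<close>. So \<open>l\<close>
  would be a tight ancestor of \<open>k\<close>.\<close>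

lemma tight_minimal_critical:
  assumes K: "K \<subseteq> V" and u: "u \<in> V - K" and k: "k \<in> tight K x u"
    and min: "\<And>l. l \<in> tight K x u \<Longrightarrow> (l, k) \<notin> E\<^sup>+"
  shows "(u, k) \<in> critical_dag V E c K"
proof -
  have kK: "k \<in> K" and pos: "0 < kleene k u"
    and tight_k: "\<And>l. l \<in> K \<Longrightarrow> kleene l u * x k \<le> kleene k u * x l"
    using k by (auto simp: tight_def)
  have "k \<noteq> u" using kK u by auto
  have "\<not> factors_through p K" if p: "critical_path E c u p k" for p
  proof
    assume "factors_through p K"
    then obtain l where l: "l \<in> K" "l \<in> set p" "l \<noteq> u" "l \<noteq> k"
      using p by (auto simp: factors_through_def critical_path_def dipath_def)
    have eq: "kleene k u = kleene k l * kleene l u" by (rule kleene_split_critical[OF p l(2-4)])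
    have kl: "0 < kleene k l" and lu: "0 < kleene l u"
      using pos kleene_nonneg[of k l] kleene_nonneg[of l u] unfolding eq
      by (auto simp: zero_less_mult_iff)
    have "kleene m u * x l \<le> kleene l u * x m" if m: "m \<in> K" for m
    proof -
      have "kleene k l * (kleene m u * x l) = kleene m u * (kleene k l * x l)" by simp
      also have "\<dots> \<le> kleene m u * x k"
        using x_ge_kleene kK K by (intro mult_left_mono) auto
      also have "\<dots> \<le> kleene k u * x m" by (rule tight_k[OF m])
      also have "\<dots> = kleene k l * (kleene l u * x m)" by (simp add: eq)
      finally show ?thesis using kl by simp
    qed
    then have "l \<in> tight K x u" using l lu by (simp add: tight_def)
    then show False using min kleene_pos_trancl[OF kl] l by blast
  qed
  then show ?thesis
    using pos \<open>k \<noteq> u\<close> u kK K by (auto simp: critical_dag_def kleene_def)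
qed

lemma tight_eq_common_child:
  assumes K: "K \<subseteq> V" and u: "u \<in> V - K" and v: "v \<in> V - K"
    and eq: "tight K x u = tight K x v" and ne: "tight K x u \<noteq> {}"
  obtains k where "k \<in> K" "(u, k) \<in> critical_dag V E c K" "(v, k) \<in> critical_dag V E c K"
proof -
  have "wf (E\<^sup>+)"
    using finite_V edges_in_V acyclic_E by (intro wf_trancl finite_acyclic_wf) (auto intro: finite_subset)
  then obtain k where k: "k \<in> tight K x u" "\<And>l. (l, k) \<in> E\<^sup>+ \<Longrightarrow> l \<notin> tight K x u"
    using ne by (metis wfE_min ex_in_conv)
  show ?thesis
  proof
    show "k \<in> K" using k by (simp add: tight_def)
    show "(u, k) \<in> critical_dag V E c K" using k by (intro tight_minimal_critical K u) auto
    show "(v, k) \<in> critical_dag V E c K" using k eq by (intro tight_minimal_critical K v) auto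
  qed
qed

end

section \<open>Recovering the sources from generic observations\<close>

locale generic_max_linear_solution = max_linear_solution V E c z x
  for V :: "'v set" and E :: "('v \<times> 'v) set" and c :: "'v \<Rightarrow> 'v \<Rightarrow> real" and z x :: "'v \<Rightarrow> real" +
  fixes K :: "'v set"
  assumes gen: "generic z" and K: "K \<subseteq> V"
begin

abbreviation source :: "'v \<Rightarrow> 'v \<Rightarrow> bool" where
  "source k s \<equiv> k \<in> K \<and> s \<in> V \<and> x k = kleene k s * z s"

lemma source_tight:
  assumes "source k s" shows "k \<in> tight K x s"
proof -
  have "0 < kleene k s" using assms K source_kleene_pos by blast
  moreover have "kleene l s * x k \<le> kleene k s * x l" if "l \<in> K" for l
  proof -
    have "kleene l s * x k = kleene k s * (kleene l s * z s)" using assms by simp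
    also have "\<dots> \<le> kleene k s * x l"
      using x_ge_kleene_z assms that K by (intro mult_left_mono) auto
    finally show ?thesis .
  qed
  ultimately show ?thesis using assms by (simp add: tight_def)
qed

text \<open>Two tight nodes give the same bound on the innovation at \<open>u\<close>, which genericity forbids for nodes
  with different sources.\<close>

lemma tight_same_source:
  assumes u: "u \<in> V" and k: "k \<in> tight K x u" and l: "l \<in> tight K x u" and s: "source k s"
  shows "source l s"
proof -
  have lV: "l \<in> V" and lK: "l \<in> K" and kV: "k \<in> V" and lu: "0 < kleene l u"
    using k l K by (auto simp: tight_def)
  obtain t where t: "t \<in> V" "x l = kleene l t * z t" using x_source[OF lV] .
  have "kleene l u * x k = kleene k u * x l"
    using k l by (intro antisym) (auto simp: tight_def)
  then have "kleene l u * kleene k s * z s = kleene k u * kleene l t * z t"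
    using s t by simp
  moreover have "0 < kleene k s" using source_kleene_pos s kV by blast
  ultimately have "s = t" using gen lV kV u s t lu unfolding generic_def by blast
  then show ?thesis using t lK by simp
qed

lemma tight_subset_source:
  assumes "u \<in> V" "k \<in> tight K x u" "source k s" shows "tight K x u \<subseteq> tight K x s"
  using tight_same_source[OF assms(1,2) _ assms(3)] source_tight by blast

text \<open>The partition into \<open>obs_part\<close> and its complement, computed from the observed values alone, tells on which
  side of \<open>src_part\<close> the source of each observed node lies. The set of a source is maximal, and a maximal set
  that contains \<open>k\<close> equals the set of the source of \<open>k\<close>; the separation hypothesis keeps that source out
  of \<open>Q'\<close> if the maximal set belongs to a node of \<open>Q\<close>.\<close>

lemma source_in_src_part_iff:
  assumes Q: "Q \<subseteq> V" "Q \<inter> Q' = {}"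
    and sep: "\<And>u v. u \<in> Q \<Longrightarrow> v \<in> Q' \<Longrightarrow> tight K x u = tight K x v \<Longrightarrow> tight K x u = {}"
    and s: "source k s"
  shows "s \<in> src_part (tight K x) Q Q' \<longleftrightarrow> k \<in> obs_part (tight K x) Q"
proof
  let ?T = "obs_part (tight K x) Q"
  assume "k \<in> ?T"
  then obtain u where u: "u \<in> Q" "k \<in> tight K x u"
    and max: "\<And>j. j \<in> V \<Longrightarrow> tight K x u \<subseteq> tight K x j \<Longrightarrow> tight K x j \<subseteq> tight K x u"
    by (auto simp: obs_part_def)
  have "tight K x u = tight K x s"
    using tight_subset_source[of u k s] max[of s] u Q s by auto
  then have "s \<notin> Q'" using sep[of u s] u by blast
  then show "s \<in> src_part (tight K x) Q Q'"
    using \<open>k \<in> ?T\<close> source_tight[OF s] s by (auto simp: src_part_def)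
next
  let ?T = "obs_part (tight K x) Q"
  assume "s \<in> src_part (tight K x) Q Q'"
  then consider "s \<in> Q" | l where "l \<in> tight K x s" "l \<in> ?T" by (auto simp: src_part_def)
  then show "k \<in> ?T"
  proof cases
    case 1
    have "tight K x j \<subseteq> tight K x s" if "j \<in> V" "tight K x s \<subseteq> tight K x j" for j
      using tight_subset_source[of j k s] that source_tight[OF s] s by blast
    then show ?thesis using 1 source_tight[OF s] by (auto simp: obs_part_def)
  next
    case 2
    then obtain u where u: "u \<in> Q" "l \<in> tight K x u"
      and max: "\<And>j. j \<in> V \<Longrightarrow> tight K x u \<subseteq> tight K x j \<Longrightarrow> tight K x j \<subseteq> tight K x u"
      by (auto simp: obs_part_def)
    have "source l s" using tight_same_source[OF _ source_tight[OF s] 2(1) s] s by blast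
    then have "tight K x u = tight K x s"
      using tight_subset_source[of u l s] max[of s] u Q s by auto
    then show ?thesis using u max source_tight[OF s] unfolding obs_part_def by blast
  qed
qed

lemma x_src_part:
  assumes Q: "Q \<subseteq> V" "Q \<inter> Q' = {}"
    and sep: "\<And>u v. u \<in> Q \<Longrightarrow> v \<in> Q' \<Longrightarrow> tight K x u = tight K x v \<Longrightarrow> tight K x u = {}"
    and k: "k \<in> K"
  shows "x k = wmax (if k \<in> obs_part (tight K x) Q then src_part (tight K x) Q Q'
    else V - src_part (tight K x) Q Q') k z" (is "_ = wmax ?P k z")
proof (rule antisym)
  have "?P \<subseteq> V" using Q by (auto simp: src_part_def)
  then have fin: "finite ?P" using finite_V finite_subset by blast
  obtain s where s: "s \<in> V" "x k = kleene k s * z s" using x_source k K by blast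
  have "s \<in> ?P" using source_in_src_part_iff[of Q Q' k s] Q sep s k by auto
  from wmax_ge[OF fin this, of k z] show "x k \<le> wmax ?P k z" using s by simp
  have "k \<in> V" using k K by blast
  then have "\<forall>j\<in>?P. kleene k j * z j \<le> x k" "0 \<le> x k"
    using x_ge_kleene_z x_pos[of k] \<open>?P \<subseteq> V\<close> by (blast, simp)
  then show "wmax ?P k z \<le> x k" using wmax_le_iff[OF fin] by blast
qed

end

section \<open>Star-connecting paths between local sources\<close>

text \<open>The five forms of \<open>*\<close>-connecting paths are exactly the ways in which the local sources \<open>u\<close> of \<open>i\<close> and
  \<open>v\<close> of \<open>j\<close> can coincide or share a child in \<open>K\<close>. If \<open>u = j\<close> or \<open>v = i\<close>, the nodes of the path would
  not be distinct, but then there is an edge between \<open>i\<close> and \<open>j\<close>.\<close>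

lemma star_connecting_joins:
  assumes "i \<notin> K" "j \<notin> K" "i \<noteq> j" "u \<notin> K" "v \<notin> K"
    and u: "u = i \<or> (u, i) \<in> G" and v: "v = j \<or> (v, j) \<in> G"
    and uv: "u = v \<or> (\<exists>k\<in>K. (u, k) \<in> G \<and> (v, k) \<in> G)"
  shows "\<exists>p. star_connecting G K p \<and> hd p = i \<and> last p = j"
proof -
  have ij: ?thesis if "(i, j) \<in> G"
    using that assms star_form.a[of i j K G] by (intro exI[of _ "[i, j]"]) (auto simp: star_connecting_def)
  have ji: ?thesis if "(j, i) \<in> G"
    using that assms star_form.a[of j i K G] by (intro exI[of _ "[i, j]"]) (auto simp: star_connecting_def)
  consider "(i, j) \<in> G" | "(j, i) \<in> G" | "u = v" "u \<noteq> i" "u \<noteq> j"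
    | k where "k \<in> K" "(u, k) \<in> G" "(v, k) \<in> G" "u \<noteq> v" "u \<noteq> j" "v \<noteq> i"
    using u v uv assms(3) by metis
  then show ?thesis
  proof cases
    case 3
    then show ?thesis using assms star_form.b[of i u j K G]
      by (intro exI[of _ "[i, u, j]"]) (auto simp: star_connecting_def)
  next
    case (4 k)
    note k = 4
    then have ne: "k \<noteq> i" "k \<noteq> j" "k \<noteq> u" "k \<noteq> v" using assms by auto
    consider "u = i" "v = j" | "u = i" "v \<noteq> j" | "u \<noteq> i" "v = j" | "u \<noteq> i" "v \<noteq> j" by blast
    then show ?thesis
    proof cases
      case 1
      then show ?thesis using k ne assms star_form.c[of i k j K G]
        by (intro exI[of _ "[i, k, j]"]) (auto simp: star_connecting_def)
    next
      case 2
      then show ?thesis using k ne assms star_form.d[of j v k i K G]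
        by (intro exI[of _ "[i, k, v, j]"]) (auto simp: star_connecting_def)
    next
      case 3
      then show ?thesis using k ne assms star_form.d[of i u k j K G]
        by (intro exI[of _ "[i, u, k, j]"]) (auto simp: star_connecting_def)
    next
      case 4
      then show ?thesis using k ne assms star_form.e[of i u k v j K G]
        by (intro exI[of _ "[i, u, k, v, j]"]) (auto simp: star_connecting_def)
    qed
  qed (use ij ji in auto)
qed

section \<open>Measurability of weighted maxima\<close>

lemma measurable_if_const:
  "f \<in> measurable M N \<Longrightarrow> g \<in> measurable M N \<Longrightarrow> (\<lambda>x. if b then f x else g x) \<in> measurable M N"
  by simp

context weighted_dag
begin

lemma measurable_wmax:
  assumes "finite P" "\<And>j. j \<in> P \<Longrightarrow> (\<lambda>\<omega>. y \<omega> j) \<in> borel_measurable M"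
  shows "(\<lambda>\<omega>. wmax P i (y \<omega>)) \<in> borel_measurable M"
proof (cases "P = {}")
  case False
  have "(\<lambda>\<omega>. wmax P i (y \<omega>)) = (\<lambda>\<omega>. max 0 (Max ((\<lambda>j. kleene i j * y \<omega> j) ` P)))"
    using assms False by (auto simp: wmax_def)
  moreover have "(\<lambda>\<omega>. Max ((\<lambda>j. kleene i j * y \<omega> j) ` P)) \<in> borel_measurable M"
    using assms by (intro borel_measurable_Max borel_measurable_times) auto
  ultimately show ?thesis by simp
qed (simp add: wmax_def)

lemma measurable_hidden_value:
  assumes "i \<in> V" "finite K" "local_sources K i \<subseteq> P"
  shows "(\<lambda>(z, y). hidden_value K i z y) \<in>
    borel_measurable (PiM P (\<lambda>_. borel) \<Otimes>\<^sub>M PiM K (\<lambda>_. borel))"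
  unfolding hidden_value_def split_beta'
  using assms finite_subset[OF local_sources_subset] finite_V
  by (intro borel_measurable_max measurable_wmax measurable_compose[OF measurable_fst]
      measurable_compose[OF measurable_snd] measurable_component_singleton) auto

lemma sets_tight_eq:
  assumes "finite K"
  shows "{y \<in> space (PiM K (\<lambda>_. borel)). \<forall>j\<in>V. tight K y j = \<tau> j} \<in> sets (PiM K (\<lambda>_. borel))"
    (is "?D \<in> _")
proof (cases "\<forall>j\<in>V. \<tau> j \<subseteq> K")
  case True
  have eq: "?D = {y \<in> space (PiM K (\<lambda>_. borel)). \<forall>j\<in>V. \<forall>k\<in>K.
      (0 < kleene k j \<and> (\<forall>l\<in>K. kleene l j * y k \<le> kleene k j * y l)) = (k \<in> \<tau> j)}"
  proof -
    have "tight K y j = \<tau> j \<longleftrightarrow> (\<forall>k\<in>K. (k \<in> tight K y j) = (k \<in> \<tau> j))" if "j \<in> V" for y j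
      using True that by (auto simp: tight_def)
    then show ?thesis by (simp add: tight_def cong: ball_cong)
  qed
  have le: "Measurable.pred (PiM K (\<lambda>_. borel)) (\<lambda>y. a * y k \<le> b * (y l :: real))"
    if "k \<in> K" "l \<in> K" for a b k l
  proof -
    have "(\<lambda>y. a * y k) \<in> borel_measurable (PiM K (\<lambda>_. borel))"
      "(\<lambda>y. b * (y l :: real)) \<in> borel_measurable (PiM K (\<lambda>_. borel))"
      using that by (auto intro!: borel_measurable_times measurable_component_singleton)
    from borel_measurable_le[OF this] show ?thesis by (simp add: pred_def)
  qed
  show ?thesis
    unfolding eq pred_def[symmetric]
    using assms finite_V
    by (intro pred_intros_finite pred_intros_logic) (auto intro: le)
next
  case False
  then have "?D = {}" by (auto simp: tight_def)
  then show ?thesis by (simp only: sets.empty_sets)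
qed

end


section \<open>Conditional independence in max-linear Bayesian networks\<close>

context max_linear_bayesian_network
begin

(* Keeps the interval {1..d} in the syntactic form in which it instantiates the locale. *)
declare One_nat_def [simp del]

sublocale dag: weighted_dag "{1..d}" E c
proof
  show "0 < c i j" if "(j, i) \<in> E" for i j
    using that edges coeff_pos_iff[of i j] by auto
qed (use edges acyclic in auto)

lemma measurable_X: "i \<in> {1..d} \<Longrightarrow> X i \<in> borel_measurable M"
proof -
  have "wf E"
    using edges acyclic by (intro finite_acyclic_wf) (auto intro: finite_subset)
  then have "i \<in> {1..d} \<longrightarrow> X i \<in> borel_measurable M"
  proof (induction i rule: wf_induct_rule)
    case (less i)
    show ?case
    proof
      assume i: "i \<in> {1..d}"
      let ?pa = "{j. (j, i) \<in> E}"
      have pa: "?pa \<subseteq> {1..d}" using edges by auto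
      then have fin: "finite ?pa" by (rule finite_subset) simp
      have Z: "Z i \<in> borel_measurable M" using indep i by (auto simp: indep_vars_def)
      have pa_meas: "(\<lambda>\<omega>. c i j * X j \<omega>) \<in> borel_measurable M" if "j \<in> ?pa" for j
        using less[of j] that pa by (intro borel_measurable_times) auto
      have eq: "X i \<omega> = (if ?pa = {} then Z i \<omega> else max (Z i \<omega>) (Max ((\<lambda>j. c i j * X j \<omega>) ` ?pa)))"
        if "\<omega> \<in> space M" for \<omega>
      proof -
        have "{c i j * X j \<omega> | j. (j, i) \<in> E} = (\<lambda>j. c i j * X j \<omega>) ` ?pa" by auto
        then show ?thesis using fin recursion[OF i that] by simp
      qed
      have "(\<lambda>\<omega>. if ?pa = {} then Z i \<omega> else max (Z i \<omega>) (Max ((\<lambda>j. c i j * X j \<omega>) ` ?pa)))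
          \<in> borel_measurable M"
      proof (cases "?pa = {}")
        case False
        then show ?thesis
          using Z borel_measurable_Max[OF fin pa_meas] by (simp only: if_False) (rule borel_measurable_max)
      qed (use Z in simp)
      then show "X i \<in> borel_measurable M" using eq by (subst measurable_cong)
    qed
  qed
  then show "i \<in> {1..d} \<Longrightarrow> X i \<in> borel_measurable M" by blast
qed

lemma AE_generic_solution:
  assumes K: "K \<subseteq> {1..d}"
  shows "AE \<omega> in M. generic_max_linear_solution {1..d} E c (\<lambda>i. Z i \<omega>) (\<lambda>i. X i \<omega>) K"
proof -
  let ?V = "{1..d}"
  have pos: "AE \<omega> in M. \<forall>i\<in>?V. 0 < Z i \<omega>"
    using pos by (intro AE_finite_allI) auto
  have "AE \<omega> in M. dag.generic (\<lambda>i. Z i \<omega>)"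
    unfolding dag.generic_def
  proof (intro AE_finite_allI)
    fix s t u k l assume V: "s \<in> ?V" "t \<in> ?V" "u \<in> ?V" "k \<in> ?V" "l \<in> ?V"
    show "AE \<omega> in M. s \<noteq> t \<longrightarrow> 0 < dag.kleene k s \<longrightarrow> 0 < dag.kleene l u \<longrightarrow>
        dag.kleene l u * dag.kleene k s * Z s \<omega> \<noteq> dag.kleene k u * dag.kleene l t * Z t \<omega>"
    proof (cases "s \<noteq> t \<and> 0 < dag.kleene k s \<and> 0 < dag.kleene l u")
      case True
      then have "AE \<omega> in M. (dag.kleene l u * dag.kleene k s) * Z s \<omega> \<noteq>
          (dag.kleene k u * dag.kleene l t) * Z t \<omega>"
        using V by (intro AE_indep_no_coincidence indep_vars_indep_var[OF indep] atom_free) auto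
      then show ?thesis by simp
    qed auto
  qed auto
  with pos AE_space show ?thesis
  proof eventually_elim
    case (elim \<omega>)
    show ?case
      by unfold_locales (use elim K recursion in auto)
  qed
qed


text \<open>The pair argument makes it a measurable map on a product space.\<close>

definition hidden_vector :: "nat set \<Rightarrow> nat set \<Rightarrow> (nat \<Rightarrow> real) \<times> (nat \<Rightarrow> real) \<Rightarrow> nat \<Rightarrow> real" where
  "hidden_vector I K = (\<lambda>(z, y). \<lambda>i\<in>I. dag.hidden_value K i z y)"

lemma measurable_hidden_vector:
  assumes "I \<subseteq> {1..d}" "K \<subseteq> {1..d}" "\<And>i. i \<in> I \<Longrightarrow> dag.local_sources K i \<subseteq> P"
  shows "hidden_vector I K \<in> measurable (PiM P (\<lambda>_. borel) \<Otimes>\<^sub>M PiM K (\<lambda>_. borel)) (PiM I (\<lambda>_. borel))"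
proof -
  have "finite K" using assms finite_subset by blast
  then have "(\<lambda>z. \<lambda>i\<in>I. (\<lambda>(z, y). dag.hidden_value K i z y) z) \<in>
      measurable (PiM P (\<lambda>_. borel) \<Otimes>\<^sub>M PiM K (\<lambda>_. borel)) (PiM I (\<lambda>_. borel))"
    using assms by (intro measurable_restrict dag.measurable_hidden_value) auto
  then show ?thesis by (simp add: hidden_vector_def split_beta')
qed

lemma hidden_vector_eq:
  assumes sol: "generic_max_linear_solution {1..d} E c (\<lambda>i. Z i \<omega>) (\<lambda>i. X i \<omega>) K"
    and I: "I \<subseteq> {1..d}" "I \<inter> K = {}" and P: "\<And>i. i \<in> I \<Longrightarrow> dag.local_sources K i \<subseteq> P"
  shows "(\<lambda>i\<in>I. X i \<omega>) = hidden_vector I K (\<lambda>j\<in>P. Z j \<omega>, \<lambda>k\<in>K. X k \<omega>)"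
proof -
  interpret generic_max_linear_solution "{1..d}" E c "\<lambda>i. Z i \<omega>" "\<lambda>i. X i \<omega>" K by (fact sol)
  have "X i \<omega> = dag.hidden_value K i (\<lambda>j\<in>P. Z j \<omega>) (\<lambda>k\<in>K. X k \<omega>)" if "i \<in> I" for i
  proof -
    have "i \<in> {1..d} - K" using I that by blast
    then have "X i \<omega> = dag.hidden_value K i (\<lambda>j. Z j \<omega>) (\<lambda>k. X k \<omega>)"
      by (rule x_local_decomposition[OF _ K])
    also have "\<dots> = dag.hidden_value K i (\<lambda>j\<in>P. Z j \<omega>) (\<lambda>k\<in>K. X k \<omega>)"
      using P[OF that] by (intro dag.hidden_value_cong) auto
    finally show ?thesis .
  qed
  then show ?thesis by (auto simp: hidden_vector_def)
qed

lemma separated_sources: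
  assumes I: "I \<subseteq> {1..d}" and J: "J \<subseteq> {1..d}"
    and disj: "I \<inter> J = {}" "I \<inter> K = {}" "J \<inter> K = {}"
    and no_path: "\<not> (\<exists>p. star_connecting (critical_dag {1..d} E c K) K p \<and> hd p \<in> I \<and> last p \<in> J)"
    and u: "u \<in> (\<Union>i\<in>I. dag.local_sources K i)" and v: "v \<in> (\<Union>j\<in>J. dag.local_sources K j)"
  shows "u \<noteq> v" "\<not> (\<exists>k\<in>K. (u, k) \<in> critical_dag {1..d} E c K \<and> (v, k) \<in> critical_dag {1..d} E c K)"
proof -
  let ?G = "critical_dag {1..d} E c K"
  obtain i j where i: "i \<in> I" "u \<notin> K" "u = i \<or> (u, i) \<in> ?G" and j: "j \<in> J" "v \<notin> K" "v = j \<or> (v, j) \<in> ?G"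
    using u v by (auto simp: dag.local_sources_def)
  have "i \<notin> K" "j \<notin> K" "i \<noteq> j" using i j disj by auto
  then have "\<not> (u = v \<or> (\<exists>k\<in>K. (u, k) \<in> ?G \<and> (v, k) \<in> ?G))"
    using star_connecting_joins[of i K j u v ?G] i j no_path by blast
  then show "u \<noteq> v" "\<not> (\<exists>k\<in>K. (u, k) \<in> ?G \<and> (v, k) \<in> ?G)" by auto
qed

lemma split_on_tight_event:
  assumes Q: "Q \<subseteq> {1..d}" "Q \<inter> Q' = {}"
    and QK: "Q \<inter> K = {}" "Q' \<subseteq> {1..d} - K"
    and no_common: "\<And>u v. u \<in> Q \<Longrightarrow> v \<in> Q' \<Longrightarrow>
      \<not> (\<exists>k\<in>K. (u, k) \<in> critical_dag {1..d} E c K \<and> (v, k) \<in> critical_dag {1..d} E c K)"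
    and sol: "generic_max_linear_solution {1..d} E c (\<lambda>i. Z i \<omega>) (\<lambda>i. X i \<omega>) K"
    and \<tau>: "\<And>j. j \<in> {1..d} \<Longrightarrow> dag.tight K (\<lambda>k. X k \<omega>) j = \<tau> j"
    and k: "k \<in> K"
  shows "X k \<omega> = dag.wmax (if k \<in> dag.obs_part \<tau> Q then dag.src_part \<tau> Q Q'
    else {1..d} - dag.src_part \<tau> Q Q') k (\<lambda>j. Z j \<omega>)"
proof -
  interpret generic_max_linear_solution "{1..d}" E c "\<lambda>i. Z i \<omega>" "\<lambda>i. X i \<omega>" K by (fact sol)
  have sep: "dag.tight K (\<lambda>k. X k \<omega>) u = {}"
    if uv: "u \<in> Q" "v \<in> Q'" "dag.tight K (\<lambda>k. X k \<omega>) u = dag.tight K (\<lambda>k. X k \<omega>) v" for u v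
  proof (rule ccontr)
    assume "dag.tight K (\<lambda>k. X k \<omega>) u \<noteq> {}"
    moreover have "u \<in> {1..d} - K" "v \<in> {1..d} - K" using that Q QK by auto
    ultimately obtain k where "k \<in> K" "(u, k) \<in> critical_dag {1..d} E c K" "(v, k) \<in> critical_dag {1..d} E c K"
      using tight_eq_common_child[OF K _ _ uv(3)] by blast
    then show False using no_common uv by blast
  qed
  have "X k \<omega> = dag.wmax (if k \<in> dag.obs_part (dag.tight K (\<lambda>i. X i \<omega>)) Q
      then dag.src_part (dag.tight K (\<lambda>i. X i \<omega>)) Q Q'
      else {1..d} - dag.src_part (dag.tight K (\<lambda>i. X i \<omega>)) Q Q') k (\<lambda>j. Z j \<omega>)"
    by (rule x_src_part[OF Q _ k]) (use sep in blast)
  moreover have "dag.obs_part (dag.tight K (\<lambda>i. X i \<omega>)) Q = dag.obs_part \<tau> Q"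
    by (rule dag.obs_part_cong) (use \<tau> Q in auto)
  moreover have "dag.src_part (dag.tight K (\<lambda>i. X i \<omega>)) Q Q' = dag.src_part \<tau> Q Q'"
    by (rule dag.src_part_cong) (use \<tau> Q in auto)
  ultimately show ?thesis by (simp only:)
qed

text \<open>On the event \<open>Y \<in> D\<close>, that is, for fixed sets of tight nodes, \<open>Y\<close> splits into its coordinates in \<open>T\<close>,
  which are the maxima over \<open>P\<close>, and the others, which are the maxima over the complement. Conversely, the
  pair of these maxima determines whether the event occurs, provided that the maxima over \<open>P\<close> do not
  exceed \<open>Y\<close> outside \<open>T\<close> (in \<open>E1\<close>) and those over the complement do not exceed \<open>Y\<close> on \<open>T\<close> (in \<open>E2\<close>).\<close>

lemma cond_density_on_tight_event:
  fixes \<tau> :: "nat \<Rightarrow> nat set" and I J K :: "nat set"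
  defines "Y \<equiv> \<lambda>\<omega>. \<lambda>k\<in>K. X k \<omega>"
  defines "D \<equiv> {y \<in> space (PiM K (\<lambda>_. borel)). \<forall>j\<in>{1..d}. dag.tight K y j = \<tau> j}"
  assumes I: "I \<subseteq> {1..d}" and J: "J \<subseteq> {1..d}" and K: "K \<subseteq> {1..d}"
    and disj: "I \<inter> J = {}" "I \<inter> K = {}" "J \<inter> K = {}"
    and no_path: "\<not> (\<exists>p. star_connecting (critical_dag {1..d} E c K) K p \<and> hd p \<in> I \<and> last p \<in> J)"
    and A: "A \<in> sets (PiM I (\<lambda>_. borel))"
  shows "\<exists>q\<in>borel_measurable (PiM K (\<lambda>_. borel)). \<forall>B\<in>sets (PiM J (\<lambda>_. borel)). \<forall>C\<in>sets (PiM K (\<lambda>_. borel)).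
      (\<integral>\<^sup>+ \<omega>. indicator A (\<lambda>i\<in>I. X i \<omega>) * (indicator B (\<lambda>j\<in>J. X j \<omega>) * indicator C (Y \<omega>)) * indicator D (Y \<omega>) \<partial>M) =
      (\<integral>\<^sup>+ \<omega>. q (Y \<omega>) * (indicator B (\<lambda>j\<in>J. X j \<omega>) * indicator C (Y \<omega>)) * indicator D (Y \<omega>) \<partial>M)"
proof -
  let ?V = "{1..d}"
  define Q where "Q = (\<Union>i\<in>I. dag.local_sources K i)"
  define Q' where "Q' = (\<Union>j\<in>J. dag.local_sources K j)"
  have Q: "Q \<subseteq> ?V - K" "Q' \<subseteq> ?V - K"
    unfolding Q_def Q'_def using I J dag.local_sources_subset[of _ K] by blast+
  note sep = separated_sources[OF I J disj no_path, folded Q_def Q'_def]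
  have QQ': "Q \<inter> Q' = {}" using sep(1) by blast
  define T where "T = dag.obs_part \<tau> Q"
  define P where "P = dag.src_part \<tau> Q Q'"
  have P: "P \<subseteq> ?V" "Q \<subseteq> P" "Q' \<subseteq> ?V - P"
    using Q QQ' by (auto simp: P_def dag.src_part_def)
  have PI: "dag.local_sources K i \<subseteq> P" if "i \<in> I" for i using that P by (auto simp: Q_def)
  have PJ: "dag.local_sources K j \<subseteq> ?V - P" if "j \<in> J" for j using that P by (auto simp: Q'_def)
  have fin: "finite K" "finite P" "finite (?V - P)"
    using finite_subset[OF K] finite_subset[OF P(1)] by auto
  let ?N1 = "PiM P (\<lambda>_. borel :: real measure)" and ?N2 = "PiM (?V - P) (\<lambda>_. borel :: real measure)"
    and ?N3 = "PiM K (\<lambda>_. borel :: real measure)"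
  define U where "U = (\<lambda>\<omega>. \<lambda>j\<in>P. Z j \<omega>)"
  define W where "W = (\<lambda>\<omega>. \<lambda>j\<in>?V - P. Z j \<omega>)"
  (* The coordinates that belong to the other map are set to the dummy value 0, so that both maps
     have values in the space of vectors indexed by K. *)
  define f where "f u = (\<lambda>k\<in>K. if k \<in> T then dag.wmax P k u else 0)" for u
  define g where "g w = (\<lambda>k\<in>K. if k \<in> T then 0 else dag.wmax (?V - P) k w)" for w
  define comb where "comb = (\<lambda>(m, n). \<lambda>k\<in>K. if k \<in> T then m k else n k :: real)"
  define split where "split y = ((\<lambda>k\<in>K. if k \<in> T then y k else 0), (\<lambda>k\<in>K. if k \<in> T then 0 else y k :: real))" for y
  define E1 where "E1 = {p \<in> space (?N1 \<Otimes>\<^sub>M ?N3). comb (f (fst p), snd p) \<in> D \<and>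
    (\<forall>k\<in>K - T. dag.wmax P k (fst p) \<le> snd p k)}"
  define E2 where "E2 = {p \<in> space (?N2 \<Otimes>\<^sub>M ?N3). \<forall>k\<in>K \<inter> T. dag.wmax (?V - P) k (fst p) \<le> snd p k}"
  have Y[measurable]: "random_variable ?N3 Y"
    unfolding Y_def using K measurable_X by (intro measurable_restrict) auto
  have ind: "indep_var ?N1 U ?N2 W"
    unfolding U_def W_def using P by (intro indep_var_restrict[OF indep]) auto
  have [measurable]: "random_variable ?N1 U" "random_variable ?N2 W"
    using ind by (auto dest: indep_var_rv1 indep_var_rv2)
  have D[measurable]: "D \<in> sets ?N3" unfolding D_def by (rule dag.sets_tight_eq[OF fin(1)])
  have wP: "(\<lambda>u. dag.wmax P k u) \<in> borel_measurable ?N1" for k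
    using fin by (intro dag.measurable_wmax measurable_component_singleton)
  have wVP: "(\<lambda>w. dag.wmax (?V - P) k w) \<in> borel_measurable ?N2" for k
    using fin by (intro dag.measurable_wmax measurable_component_singleton)
  have f[measurable]: "f \<in> measurable ?N1 ?N3"
    unfolding f_def by (intro measurable_restrict) (auto intro: wP measurable_if_const)
  have g[measurable]: "g \<in> measurable ?N2 ?N3"
    unfolding g_def by (intro measurable_restrict) (auto intro: wVP measurable_if_const)
  have comp: "(\<lambda>y. y k) \<in> borel_measurable ?N3" if "k \<in> K" for k
    using that by (rule measurable_component_singleton)
  have comb[measurable]: "comb \<in> measurable (?N3 \<Otimes>\<^sub>M ?N3) ?N3"
    unfolding comb_def split_beta'
    by (intro measurable_restrict measurable_if_const)
      (auto intro: measurable_compose[OF measurable_fst comp] measurable_compose[OF measurable_snd comp])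
  have split[measurable]: "split \<in> measurable ?N3 (?N3 \<Otimes>\<^sub>M ?N3)"
    unfolding split_def by (intro measurable_Pair measurable_restrict measurable_if_const) (auto intro: comp)
  have E1: "E1 \<in> sets (?N1 \<Otimes>\<^sub>M ?N3)"
  proof -
    have "{p \<in> space (?N1 \<Otimes>\<^sub>M ?N3). comb (f (fst p), snd p) \<in> D} \<in> sets (?N1 \<Otimes>\<^sub>M ?N3)"
      by measurable
    moreover have "{p \<in> space (?N1 \<Otimes>\<^sub>M ?N3). \<forall>k\<in>K - T. dag.wmax P k (fst p) \<le> snd p k} \<in> sets (?N1 \<Otimes>\<^sub>M ?N3)"
      using fin by (intro sets.sets_Collect_finite_All borel_measurable_le
          measurable_compose[OF measurable_fst wP] measurable_compose[OF measurable_snd comp]) auto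
    ultimately show ?thesis unfolding E1_def by (intro sets.sets_Collect_conj)
  qed
  have E2: "E2 \<in> sets (?N2 \<Otimes>\<^sub>M ?N3)"
    unfolding E2_def
    using fin by (intro sets.sets_Collect_finite_All borel_measurable_le
        measurable_compose[OF measurable_fst wVP] measurable_compose[OF measurable_snd comp]) auto
  have wU: "dag.wmax P k (U \<omega>) = dag.wmax P k (\<lambda>j. Z j \<omega>)" for k \<omega>
    by (rule dag.wmax_cong) (simp add: U_def)
  have wW: "dag.wmax (?V - P) k (W \<omega>) = dag.wmax (?V - P) k (\<lambda>j. Z j \<omega>)" for k \<omega>
    by (rule dag.wmax_cong) (simp add: W_def)
  have in_space: "U \<omega> \<in> space ?N1" "W \<omega> \<in> space ?N2" "f (U \<omega>) \<in> space ?N3" "g (W \<omega>) \<in> space ?N3"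
    "Y \<omega> \<in> space ?N3" for \<omega>
    by (auto simp: U_def W_def f_def g_def Y_def space_PiM)
  have on_event: "Y \<omega> = comb (f (U \<omega>), g (W \<omega>)) \<and> split (Y \<omega>) = (f (U \<omega>), g (W \<omega>))
      \<and> (U \<omega>, g (W \<omega>)) \<in> E1 \<and> (W \<omega>, f (U \<omega>)) \<in> E2"
    if sol: "generic_max_linear_solution ?V E c (\<lambda>i. Z i \<omega>) (\<lambda>i. X i \<omega>) K" and YD: "Y \<omega> \<in> D" for \<omega>
  proof -
    interpret generic_max_linear_solution ?V E c "\<lambda>i. Z i \<omega>" "\<lambda>i. X i \<omega>" K by (fact sol)
    have "dag.tight K (\<lambda>k. X k \<omega>) j = \<tau> j" if "j \<in> ?V" for j
      using YD that dag.tight_cong[of K "Y \<omega>" "\<lambda>k. X k \<omega>" j] by (simp add: D_def Y_def)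
    then have eq: "X k \<omega> = dag.wmax (if k \<in> T then P else ?V - P) k (\<lambda>j. Z j \<omega>)" if "k \<in> K" for k
      unfolding T_def P_def using Q QQ' sep(2) sol that by (intro split_on_tight_event) auto
    have fk: "f (U \<omega>) k = X k \<omega>" if "k \<in> K" "k \<in> T" for k
      using that eq[of k] by (simp add: f_def wU)
    have gk: "g (W \<omega>) k = X k \<omega>" if "k \<in> K" "k \<notin> T" for k
      using that eq[of k] by (simp add: g_def wW)
    have Y_eq: "Y \<omega> = comb (f (U \<omega>), g (W \<omega>))"
      using fk gk by (auto simp: Y_def comb_def)
    moreover have "split (Y \<omega>) = (f (U \<omega>), g (W \<omega>))"
      using fk gk by (auto simp: split_def Y_def f_def g_def)
    moreover have "(U \<omega>, g (W \<omega>)) \<in> E1"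
      using YD Y_eq wmax_le_x[OF P(1)] K gk in_space by (auto simp: E1_def space_pair_measure wU)
    moreover have "(W \<omega>, f (U \<omega>)) \<in> E2"
      using wmax_le_x[of "?V - P"] K fk in_space by (auto simp: E2_def space_pair_measure wW)
    ultimately show ?thesis by blast
  qed
  have on_rectangle: "Y \<omega> \<in> D"
    if sol: "generic_max_linear_solution ?V E c (\<lambda>i. Z i \<omega>) (\<lambda>i. X i \<omega>) K"
      and 1: "(U \<omega>, g (W \<omega>)) \<in> E1" and 2: "(W \<omega>, f (U \<omega>)) \<in> E2" for \<omega>
  proof -
    interpret generic_max_linear_solution ?V E c "\<lambda>i. Z i \<omega>" "\<lambda>i. X i \<omega>" K by (fact sol)
    have max: "X k \<omega> = max (dag.wmax P k (U \<omega>)) (dag.wmax (?V - P) k (W \<omega>))" if "k \<in> K" for k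
      unfolding wU wW using that K P by (intro x_eq_max_wmax) auto
    have "X k \<omega> = (if k \<in> T then f (U \<omega>) k else g (W \<omega>) k)" if "k \<in> K" for k
      using max[OF that] 1 2 that by (auto simp: E1_def E2_def f_def g_def)
    then have "Y \<omega> = comb (f (U \<omega>), g (W \<omega>))" by (auto simp: Y_def comb_def)
    then show ?thesis using 1 by (simp add: E1_def)
  qed
  note sol_AE = AE_generic_solution[OF K]
  have "hidden_vector I K \<in> measurable (?N1 \<Otimes>\<^sub>M ?N3) (PiM I (\<lambda>_. borel))"
    using I K PI by (rule measurable_hidden_vector)
  from measurable_sets[OF this A]
  have A': "hidden_vector I K -` A \<inter> space (?N1 \<Otimes>\<^sub>M ?N3) \<in> sets (?N1 \<Otimes>\<^sub>M ?N3)" (is "?A \<in> _") .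
  have hJ: "hidden_vector J K \<in> measurable (?N2 \<Otimes>\<^sub>M ?N3) (PiM J (\<lambda>_. borel))"
    using J K PJ by (rule measurable_hidden_vector)
  obtain q :: "(nat \<Rightarrow> real) \<Rightarrow> ennreal" where q: "q \<in> borel_measurable ?N3"
    and q_eq: "\<And>S. S \<in> sets (?N2 \<Otimes>\<^sub>M ?N3) \<Longrightarrow>
      (\<integral>\<^sup>+ \<omega>. indicator ?A (U \<omega>, Y \<omega>) * indicator S (W \<omega>, Y \<omega>) * indicator D (Y \<omega>) \<partial>M) =
      (\<integral>\<^sup>+ \<omega>. q (Y \<omega>) * indicator S (W \<omega>, Y \<omega>) * indicator D (Y \<omega>) \<partial>M)"
  proof (rule indep_var_local_factorization[OF ind f g Y D comb split E1 E2 _ _ A'])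
    show "AE \<omega> in M. Y \<omega> \<in> D \<longleftrightarrow> (U \<omega>, g (W \<omega>)) \<in> E1 \<and> (W \<omega>, f (U \<omega>)) \<in> E2"
      using sol_AE on_event on_rectangle by (auto elim!: eventually_mono)
    show "AE \<omega> in M. Y \<omega> \<in> D \<longrightarrow> Y \<omega> = comb (f (U \<omega>), g (W \<omega>)) \<and> split (Y \<omega>) = (f (U \<omega>), g (W \<omega>))"
      using sol_AE on_event by (auto elim!: eventually_mono)
  qed blast
  show ?thesis
  proof (intro bexI[OF _ q] ballI)
    fix B C assume B: "B \<in> sets (PiM J (\<lambda>_. borel :: real measure))" and C: "C \<in> sets ?N3"
    define S where "S = (hidden_vector J K -` B \<inter> space (?N2 \<Otimes>\<^sub>M ?N3)) \<inter> (snd -` C \<inter> space (?N2 \<Otimes>\<^sub>M ?N3))"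
    have S: "S \<in> sets (?N2 \<Otimes>\<^sub>M ?N3)"
      unfolding S_def using measurable_sets[OF hJ B] measurable_sets[OF measurable_snd C] by (rule sets.Int)
    have IA: "AE \<omega> in M. indicator ?A (U \<omega>, Y \<omega>) = (indicator A (\<lambda>i\<in>I. X i \<omega>) :: ennreal)"
      using sol_AE
    proof eventually_elim
      case (elim \<omega>)
      show ?case
        using hidden_vector_eq[OF elim I disj(2) PI] in_space[of \<omega>]
        by (auto simp: indicator_def space_pair_measure U_def Y_def)
    qed
    have IS: "AE \<omega> in M. indicator S (W \<omega>, Y \<omega>) = (indicator B (\<lambda>j\<in>J. X j \<omega>) * indicator C (Y \<omega>) :: ennreal)"
      using sol_AE
    proof eventually_elim
      case (elim \<omega>)
      show ?case
        using hidden_vector_eq[OF elim J disj(3) PJ] in_space[of \<omega>]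
        by (auto simp: S_def indicator_def space_pair_measure W_def Y_def)
    qed
    have "(\<integral>\<^sup>+ \<omega>. indicator A (\<lambda>i\<in>I. X i \<omega>) * (indicator B (\<lambda>j\<in>J. X j \<omega>) * indicator C (Y \<omega>)) * indicator D (Y \<omega>) \<partial>M)
      = (\<integral>\<^sup>+ \<omega>. indicator ?A (U \<omega>, Y \<omega>) * indicator S (W \<omega>, Y \<omega>) * indicator D (Y \<omega>) \<partial>M)"
      using IA IS by (intro nn_integral_cong_AE, eventually_elim) simp
    also have "\<dots> = (\<integral>\<^sup>+ \<omega>. q (Y \<omega>) * indicator S (W \<omega>, Y \<omega>) * indicator D (Y \<omega>) \<partial>M)"
      by (rule q_eq[OF S])
    also have "\<dots> = (\<integral>\<^sup>+ \<omega>. q (Y \<omega>) * (indicator B (\<lambda>j\<in>J. X j \<omega>) * indicator C (Y \<omega>)) * indicator D (Y \<omega>) \<partial>M)"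
      using IS by (intro nn_integral_cong_AE, eventually_elim) simp
    finally show "(\<integral>\<^sup>+ \<omega>. indicator A (\<lambda>i\<in>I. X i \<omega>) * (indicator B (\<lambda>j\<in>J. X j \<omega>) * indicator C (Y \<omega>)) * indicator D (Y \<omega>) \<partial>M)
      = (\<integral>\<^sup>+ \<omega>. q (Y \<omega>) * (indicator B (\<lambda>j\<in>J. X j \<omega>) * indicator C (Y \<omega>)) * indicator D (Y \<omega>) \<partial>M)" .
  qed
qed

lemma cond_indep_if_no_star_connecting:
  assumes I: "I \<subseteq> {1..d}" and J: "J \<subseteq> {1..d}" and K: "K \<subseteq> {1..d}"
    and disj: "I \<inter> J = {}" "I \<inter> K = {}" "J \<inter> K = {}"
    and no_path: "\<not> (\<exists>p. star_connecting (critical_dag {1..d} E c K) K p \<and> hd p \<in> I \<and> last p \<in> J)"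
  shows "cond_indep_var (PiM I (\<lambda>_. borel)) (\<lambda>\<omega>. \<lambda>i\<in>I. X i \<omega>) (PiM J (\<lambda>_. borel)) (\<lambda>\<omega>. \<lambda>j\<in>J. X j \<omega>)
    (PiM K (\<lambda>_. borel)) (\<lambda>\<omega>. \<lambda>k\<in>K. X k \<omega>)"
proof (rule cond_indep_varI)
  have rv: "random_variable (PiM L (\<lambda>_. borel)) (\<lambda>\<omega>. \<lambda>i\<in>L. X i \<omega>)" if "L \<subseteq> {1..d}" for L
    using that measurable_X by (intro measurable_restrict) auto
  show "random_variable (PiM I (\<lambda>_. borel)) (\<lambda>\<omega>. \<lambda>i\<in>I. X i \<omega>)"
    "random_variable (PiM J (\<lambda>_. borel)) (\<lambda>\<omega>. \<lambda>j\<in>J. X j \<omega>)"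
    "random_variable (PiM K (\<lambda>_. borel)) (\<lambda>\<omega>. \<lambda>k\<in>K. X k \<omega>)"
    by (rule rv, fact)+
  note [measurable] = this
  let ?XI = "\<lambda>\<omega>. \<lambda>i\<in>I. X i \<omega>" and ?XJ = "\<lambda>\<omega>. \<lambda>j\<in>J. X j \<omega>" and ?Y = "\<lambda>\<omega>. \<lambda>k\<in>K. X k \<omega>"
  let ?N3 = "PiM K (\<lambda>_. borel :: real measure)"
  have finK: "finite K" using K finite_subset by blast
  fix A assume A[measurable]: "A \<in> sets (PiM I (\<lambda>_. borel :: real measure))"
  (* For y in D \<tau>, the family \<tau> is determined by y on {1..d}; restricting \<tau> to extensional functions
     makes the events disjoint. *)
  define D where "D \<tau> = {y \<in> space ?N3. \<forall>j\<in>{1..d}. dag.tight K y j = \<tau> j}" for \<tau>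
  have D[measurable]: "D \<tau> \<in> sets ?N3" for \<tau> unfolding D_def by (rule dag.sets_tight_eq[OF finK])
  define Ts where "Ts = ({1..d} \<rightarrow>\<^sub>E Pow K)"
  have fin: "finite Ts" unfolding Ts_def using finK by (intro finite_PiE) auto
  have part: "(\<Sum>\<tau>\<in>Ts. indicator (D \<tau>) y) = (1 :: ennreal)" if y: "y \<in> space ?N3" for y
  proof -
    let ?t = "restrict (dag.tight K y) {1..d}"
    have t: "?t \<in> Ts" by (auto simp: Ts_def dag.tight_def)
    have "indicator (D \<tau>) y = (if \<tau> = ?t then 1 else 0 :: ennreal)" if "\<tau> \<in> Ts" for \<tau>
    proof -
      have "y \<in> D \<tau> \<longleftrightarrow> \<tau> = ?t"
        using that y unfolding Ts_def D_def by (auto intro!: PiE_ext[of \<tau> "{1..d}" "\<lambda>_. Pow K" ?t] simp: dag.tight_def)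
      then show ?thesis by (simp only: indicator_def of_bool_def)
    qed
    then have "(\<Sum>\<tau>\<in>Ts. indicator (D \<tau>) y) = (\<Sum>\<tau>\<in>Ts. if \<tau> = ?t then 1 else 0 :: ennreal)"
      by (intro sum.cong) auto
    also have "\<dots> = 1" using fin t by simp
    finally show ?thesis .
  qed
  let ?version = "\<lambda>\<tau> q. q \<in> borel_measurable ?N3 \<and>
    (\<forall>B\<in>sets (PiM J (\<lambda>_. borel)). \<forall>C\<in>sets ?N3.
      (\<integral>\<^sup>+ \<omega>. indicator A (?XI \<omega>) * (indicator B (?XJ \<omega>) * indicator C (?Y \<omega>)) * indicator (D \<tau>) (?Y \<omega>) \<partial>M) =
      (\<integral>\<^sup>+ \<omega>. q (?Y \<omega>) * (indicator B (?XJ \<omega>) * indicator C (?Y \<omega>)) * indicator (D \<tau>) (?Y \<omega>) \<partial>M))"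
  have "\<forall>\<tau>. \<exists>q. ?version \<tau> q"
  proof
    fix \<tau>
    show "\<exists>q. ?version \<tau> q"
      using cond_density_on_tight_event[OF I J K disj no_path A, of \<tau>] unfolding D_def Bex_def .
  qed
  from choice[OF this] obtain q where "\<forall>\<tau>. ?version \<tau> (q \<tau>)" by (rule exE)
  then have q[measurable]: "q \<tau> \<in> borel_measurable ?N3"
    and q_eq: "B \<in> sets (PiM J (\<lambda>_. borel)) \<Longrightarrow> C \<in> sets ?N3 \<Longrightarrow>
      (\<integral>\<^sup>+ \<omega>. indicator A (?XI \<omega>) * (indicator B (?XJ \<omega>) * indicator C (?Y \<omega>)) * indicator (D \<tau>) (?Y \<omega>) \<partial>M) =
      (\<integral>\<^sup>+ \<omega>. q \<tau> (?Y \<omega>) * (indicator B (?XJ \<omega>) * indicator C (?Y \<omega>)) * indicator (D \<tau>) (?Y \<omega>) \<partial>M)"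
    for \<tau> B C by blast+
  show "\<exists>q\<in>borel_measurable ?N3. \<forall>B\<in>sets (PiM J (\<lambda>_. borel)). \<forall>C\<in>sets ?N3.
      (\<integral>\<^sup>+ \<omega>. indicator A (?XI \<omega>) * (indicator B (?XJ \<omega>) * indicator C (?Y \<omega>)) \<partial>M) =
      (\<integral>\<^sup>+ \<omega>. q (?Y \<omega>) * (indicator B (?XJ \<omega>) * indicator C (?Y \<omega>)) \<partial>M)"
  proof (intro bexI ballI)
    show "(\<lambda>y. \<Sum>\<tau>\<in>Ts. q \<tau> y * indicator (D \<tau>) y) \<in> borel_measurable ?N3" by measurable
    fix B C assume B[measurable]: "B \<in> sets (PiM J (\<lambda>_. borel :: real measure))" and C[measurable]: "C \<in> sets ?N3"
    have Yspace: "?Y \<omega> \<in> space ?N3" for \<omega> by (auto simp: space_PiM)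
    have "(\<integral>\<^sup>+ \<omega>. indicator A (?XI \<omega>) * (indicator B (?XJ \<omega>) * indicator C (?Y \<omega>)) \<partial>M) =
        (\<integral>\<^sup>+ \<omega>. (\<Sum>\<tau>\<in>Ts. indicator A (?XI \<omega>) * (indicator B (?XJ \<omega>) * indicator C (?Y \<omega>)) * indicator (D \<tau>) (?Y \<omega>)) \<partial>M)"
      by (simp only: sum_distrib_left[symmetric] part[OF Yspace] mult_1_right)
    also have "\<dots> = (\<Sum>\<tau>\<in>Ts. \<integral>\<^sup>+ \<omega>. indicator A (?XI \<omega>) * (indicator B (?XJ \<omega>) * indicator C (?Y \<omega>)) * indicator (D \<tau>) (?Y \<omega>) \<partial>M)"
      by (rule nn_integral_sum) measurable
    also have "\<dots> = (\<Sum>\<tau>\<in>Ts. \<integral>\<^sup>+ \<omega>. q \<tau> (?Y \<omega>) * (indicator B (?XJ \<omega>) * indicator C (?Y \<omega>)) * indicator (D \<tau>) (?Y \<omega>) \<partial>M)"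
      by (rule sum.cong[OF refl q_eq[OF B C]])
    also have "\<dots> = (\<integral>\<^sup>+ \<omega>. (\<Sum>\<tau>\<in>Ts. q \<tau> (?Y \<omega>) * (indicator B (?XJ \<omega>) * indicator C (?Y \<omega>)) * indicator (D \<tau>) (?Y \<omega>)) \<partial>M)"
      by (rule nn_integral_sum[symmetric]) measurable
    also have "\<dots> = (\<integral>\<^sup>+ \<omega>. (\<Sum>\<tau>\<in>Ts. q \<tau> (?Y \<omega>) * indicator (D \<tau>) (?Y \<omega>)) * (indicator B (?XJ \<omega>) * indicator C (?Y \<omega>)) \<partial>M)"
      by (simp only: sum_distrib_left sum_distrib_right mult_ac)
    finally show "(\<integral>\<^sup>+ \<omega>. indicator A (?XI \<omega>) * (indicator B (?XJ \<omega>) * indicator C (?Y \<omega>)) \<partial>M) =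
        (\<integral>\<^sup>+ \<omega>. (\<Sum>\<tau>\<in>Ts. q \<tau> (?Y \<omega>) * indicator (D \<tau>) (?Y \<omega>)) * (indicator B (?XJ \<omega>) * indicator C (?Y \<omega>)) \<partial>M)" .
  qed
qed

end

theorem theorem5p14:
  fixes M :: "'a measure"
    and d :: nat
    and E :: "(nat \<times> nat) set"
    and c :: "nat \<Rightarrow> nat \<Rightarrow> real"
    and Z X :: "nat \<Rightarrow> 'a \<Rightarrow> real"
    and I J K :: "nat set"
  assumes "max_linear_bayesian_network M d E c Z X"
    and "I \<subseteq> {1..d}" and "J \<subseteq> {1..d}" and "K \<subseteq> {1..d}"
    and "I \<inter> J = {}" and "I \<inter> K = {}" and "J \<inter> K = {}"
    and "\<not> (\<exists>p. star_connecting (critical_dag {1..d} E c K) K p \<and> hd p \<in> I \<and> last p \<in> J)"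
  shows "prob_space.cond_indep_var M
           (PiM I (\<lambda>_. borel)) (\<lambda>\<omega>. \<lambda>i\<in>I. X i \<omega>)
           (PiM J (\<lambda>_. borel)) (\<lambda>\<omega>. \<lambda>j\<in>J. X j \<omega>)
           (PiM K (\<lambda>_. borel)) (\<lambda>\<omega>. \<lambda>k\<in>K. X k \<omega>)"
  using max_linear_bayesian_network.cond_indep_if_no_star_connecting assms by blast

end
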